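(* Given a $2$-plane drawing $\Gamma$ of a graph $G$ on $n$ vertices and $m$ edges, one can compute in time $\mathcal{O}(n+m)$ a $1$-plane $2$-edge-coloring $\varphi\colon E(G)\to\{1,2\}$ of $\Gamma$, or conclude that none exists.
   Context: Drawings are in the plane: vertices are points and edges are simple Jordan curves joining their endpoints. Edges cross only in internal points, do not share infinitely many points, do not touch, do not self-intersect, no more than two edges cross in a common point, and adjacent edges do not cross. A drawing is $k$-plane if every edge is crossed at most $k$ times. A $k$-plane $t$-edge-coloring of a drawing $\Gamma$ of $G$ is a (not necessarily proper) coloring $\varphi\colon E(G)\to\{1,\dots,t\}$ such that each edge is crossed in $\Gamma$ by at most $k$ edges of each of the $t$ colors. The drawing is assumed to be given as its planarization, i.e. the embedded graph obtained by replacing each crossing with a vertex, with labels indicating whether a vertex of the planarization is a vertex or a crossing of the drawing. *)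

theory Defs
  imports "HOL-Analysis.Analysis" "HOL-Library.Landau_Symbols"
begin

section \<open>Graphs and drawings\<close>

record ugraph =
  verts :: "nat set"
  edges :: "nat set set"

definition simple_graph :: "ugraph \<Rightarrow> bool" where
  "simple_graph G \<longleftrightarrow> finite (verts G) \<and> (\<forall>e\<in>edges G. e \<subseteq> verts G \<and> card e = 2)"

record drawing =
  point :: "nat \<Rightarrow> complex"
  curve :: "nat set \<Rightarrow> real \<Rightarrow> complex"

text \<open>
  The cyclic order of curves around a common point is read off on a small circle around that
  point. Follow the curve \<open>g\<close> from parameter \<open>s\<close>, forwards or backwards, until it first meets
  the circle of radius \<open>r\<close> around \<open>g s\<close>; \<open>exit_dir g s fwd r\<close> is the vector from \<open>g s\<close> to that
  point. For curves that are disjoint near the common point except for the point itself, the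
  cyclic order of these vectors is the same for all sufficiently small \<open>r > 0\<close>.
\<close>

definition exit_dir :: "(real \<Rightarrow> complex) \<Rightarrow> real \<Rightarrow> bool \<Rightarrow> real \<Rightarrow> complex" where
  "exit_dir g s fwd r =
     (let h = (\<lambda>u. g (if fwd then s + u else s - u))
      in h (Inf {u. 0 \<le> u \<and> dist (h u) (g s) = r}) - g s)"

definition ccw_angle :: "complex \<Rightarrow> complex \<Rightarrow> real" where
  "ccw_angle a b = Arg2pi (b / a)"

definition ccw_order4 :: "complex \<Rightarrow> complex \<Rightarrow> complex \<Rightarrow> complex \<Rightarrow> bool" where
  "ccw_order4 a b c d \<longleftrightarrow>
     0 < ccw_angle a b \<and> ccw_angle a b < ccw_angle a c \<and> ccw_angle a c < ccw_angle a d"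

text \<open>
  Two edges cross (rather than touch) at a common internal point if the two ends of one of them
  alternate with the two ends of the other around that point.
\<close>

definition crosses_at :: "drawing \<Rightarrow> nat set \<Rightarrow> nat set \<Rightarrow> complex \<Rightarrow> bool" where
  "crosses_at \<Gamma> e f p \<longleftrightarrow>
     (\<exists>s\<in>{0<..<1}. \<exists>t\<in>{0<..<1}. curve \<Gamma> e s = p \<and> curve \<Gamma> f t = p \<and>
        (\<forall>\<^sub>F r in at_right 0.
           let a  = exit_dir (curve \<Gamma> e) s True r; a' = exit_dir (curve \<Gamma> e) s False r;
               b  = exit_dir (curve \<Gamma> f) t True r; b' = exit_dir (curve \<Gamma> f) t False r
           in ccw_order4 a b a' b' \<or> ccw_order4 a b' a' b))"

definition drawing_of :: "drawing \<Rightarrow> ugraph \<Rightarrow> bool" where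
  "drawing_of \<Gamma> G \<longleftrightarrow>
     inj_on (point \<Gamma>) (verts G) \<and>
     (\<forall>e\<in>edges G. arc (curve \<Gamma> e) \<and>
        {pathstart (curve \<Gamma> e), pathfinish (curve \<Gamma> e)} = point \<Gamma> ` e) \<and>
     (\<forall>e\<in>edges G. \<forall>v\<in>verts G. point \<Gamma> v \<in> path_image (curve \<Gamma> e) \<longrightarrow> v \<in> e) \<and>
     (\<forall>e\<in>edges G. \<forall>f\<in>edges G. e \<noteq> f \<longrightarrow>
        finite (path_image (curve \<Gamma> e) \<inter> path_image (curve \<Gamma> f)) \<and>
        (\<forall>p \<in> path_image (curve \<Gamma> e) \<inter> path_image (curve \<Gamma> f).
           p \<in> point \<Gamma> ` (e \<inter> f) \<or> crosses_at \<Gamma> e f p) \<and>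
        (e \<inter> f \<noteq> {} \<longrightarrow> (\<nexists>p. crosses_at \<Gamma> e f p))) \<and>
     (\<forall>p. p \<notin> point \<Gamma> ` verts G \<longrightarrow> card {e \<in> edges G. p \<in> path_image (curve \<Gamma> e)} \<le> 2)"

text \<open>
  In a drawing the crossings on an edge correspond to its crossing points, since no three edges
  cross in a common point; there are finitely many of them.
\<close>

definition k_plane :: "nat \<Rightarrow> drawing \<Rightarrow> ugraph \<Rightarrow> bool" where
  "k_plane k \<Gamma> G \<longleftrightarrow>
     (\<forall>e\<in>edges G. card {p. \<exists>f\<in>edges G. f \<noteq> e \<and> crosses_at \<Gamma> e f p} \<le> k)"

definition k_plane_edge_coloring ::
  "nat \<Rightarrow> nat \<Rightarrow> drawing \<Rightarrow> ugraph \<Rightarrow> (nat set \<Rightarrow> nat) \<Rightarrow> bool" where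
  "k_plane_edge_coloring k t \<Gamma> G \<phi> \<longleftrightarrow>
     \<phi> ` edges G \<subseteq> {1..t} \<and>
     (\<forall>e\<in>edges G. \<forall>c\<in>{1..t}.
        card {f \<in> edges G. f \<noteq> e \<and> \<phi> f = c \<and> (\<exists>p. crosses_at \<Gamma> e f p)} \<le> k)"


section \<open>Planarizations\<close>

definition nodes :: "drawing \<Rightarrow> ugraph \<Rightarrow> complex set" where
  "nodes \<Gamma> G = point \<Gamma> ` verts G \<union>
     {p. \<exists>e\<in>edges G. \<exists>f\<in>edges G. e \<noteq> f \<and> crosses_at \<Gamma> e f p}"

definition stops :: "drawing \<Rightarrow> ugraph \<Rightarrow> nat set \<Rightarrow> real set" where
  "stops \<Gamma> G e = {s \<in> {0..1}. curve \<Gamma> e s \<in> nodes \<Gamma> G}"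

text \<open>
  The edges of the planarization are the pieces of the curves between consecutive stops. Each is
  represented by two darts (half-edges), one per direction: \<open>(e, s, fwd)\<close> leaves the node
  \<open>curve \<Gamma> e s\<close> along \<open>e\<close>, in the direction of increasing parameters iff \<open>fwd\<close>.
\<close>

type_synonym dart = "nat set \<times> real \<times> bool"

definition darts :: "drawing \<Rightarrow> ugraph \<Rightarrow> dart set" where
  "darts \<Gamma> G =
     {(e, s, fwd). e \<in> edges G \<and> s \<in> stops \<Gamma> G e \<and> (if fwd then s < 1 else 0 < s)}"

definition dart_edge :: "dart \<Rightarrow> nat set" where
  "dart_edge d = fst d"

fun dart_node :: "drawing \<Rightarrow> dart \<Rightarrow> complex" where
  "dart_node \<Gamma> (e, s, fwd) = curve \<Gamma> e s"

fun dart_exit :: "drawing \<Rightarrow> dart \<Rightarrow> real \<Rightarrow> complex" where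
  "dart_exit \<Gamma> (e, s, fwd) r = exit_dir (curve \<Gamma> e) s fwd r"

fun dart_rev :: "drawing \<Rightarrow> ugraph \<Rightarrow> dart \<Rightarrow> dart" where
  "dart_rev \<Gamma> G (e, s, fwd) =
     (e, if fwd then Min {t \<in> stops \<Gamma> G e. s < t} else Max {t \<in> stops \<Gamma> G e. t < s}, \<not> fwd)"

text \<open>
  \<open>d'\<close> is the counterclockwise successor of \<open>d\<close> around their common node, with \<open>d' = d\<close> only if
  there is no other dart at that node.
\<close>

definition ccw_next :: "drawing \<Rightarrow> ugraph \<Rightarrow> dart \<Rightarrow> dart \<Rightarrow> bool" where
  "ccw_next \<Gamma> G d d' \<longleftrightarrow>
     (let A = {x \<in> darts \<Gamma> G. dart_node \<Gamma> x = dart_node \<Gamma> d}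
      in d' \<in> A \<and>
         (\<forall>\<^sub>F r in at_right 0. \<forall>x \<in> A - {d}. d' \<noteq> d \<and>
            ccw_angle (dart_exit \<Gamma> d r) (dart_exit \<Gamma> d' r)
              \<le> ccw_angle (dart_exit \<Gamma> d r) (dart_exit \<Gamma> x r)))"

text \<open>
  An embedded graph with node labels, as a rotation system on numbered nodes and darts. Which
  edge of the drawn graph a dart belongs to is not part of the data.
\<close>

record embedded_graph =
  num_nodes :: nat
  num_darts :: nat
  crossing_node :: "nat \<Rightarrow> bool"
  origin :: "nat \<Rightarrow> nat"
  twin :: "nat \<Rightarrow> nat"
  rot :: "nat \<Rightarrow> nat"

text \<open>\<open>\<beta>\<close> names the darts of the planarization by the numbers below \<open>num_darts D\<close>.\<close>

definition planarization_of ::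
  "embedded_graph \<Rightarrow> (nat \<Rightarrow> dart) \<Rightarrow> drawing \<Rightarrow> ugraph \<Rightarrow> bool" where
  "planarization_of D \<beta> \<Gamma> G \<longleftrightarrow>
     (\<exists>\<alpha>. bij_betw \<alpha> {..<num_nodes D} (nodes \<Gamma> G) \<and>
          bij_betw \<beta> {..<num_darts D} (darts \<Gamma> G) \<and>
          (\<forall>v<num_nodes D. crossing_node D v \<longleftrightarrow> \<alpha> v \<notin> point \<Gamma> ` verts G) \<and>
          (\<forall>d<num_darts D.
             origin D d < num_nodes D \<and> \<alpha> (origin D d) = dart_node \<Gamma> (\<beta> d) \<and>
             twin D d < num_darts D \<and> \<beta> (twin D d) = dart_rev \<Gamma> G (\<beta> d) \<and>
             rot D d < num_darts D \<and> ccw_next \<Gamma> G (\<beta> d) (\<beta> (rot D d))))"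


section \<open>Random access machine\<close>

text \<open>
  Structured programs over registers and arrays of natural numbers, at unit cost per instruction
  and per test. A program is a finite syntactic object, so it uses finitely many registers and
  arrays. The only arithmetic is increment and decrement: after \<open>t\<close> steps no value exceeds the
  largest number in the input or in the program by more than \<open>t\<close>, so that in a linear-time
  computation all values fit into words of logarithmic length.
\<close>

record state =
  reg :: "nat \<Rightarrow> nat"
  arr :: "nat \<Rightarrow> nat \<Rightarrow> nat"

datatype test = Less nat nat | Equal nat nat

fun holds :: "test \<Rightarrow> state \<Rightarrow> bool" where
  "holds (Less x y) s \<longleftrightarrow> reg s x < reg s y"
| "holds (Equal x y) s \<longleftrightarrow> reg s x = reg s y"

datatype instr =
    Const nat nat
  | Copy nat nat
  | Inc nat
  | Dec nat
  | Load nat nat nat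
  | Store nat nat nat

definition set_reg :: "nat \<Rightarrow> nat \<Rightarrow> state \<Rightarrow> state" where
  "set_reg x k s = s\<lparr>reg := (reg s)(x := k)\<rparr>"

fun exec_instr :: "instr \<Rightarrow> state \<Rightarrow> state" where
  "exec_instr (Const x k) s = set_reg x k s"
| "exec_instr (Copy x y) s = set_reg x (reg s y) s"
| "exec_instr (Inc x) s = set_reg x (reg s x + 1) s"
| "exec_instr (Dec x) s = set_reg x (reg s x - 1) s"
| "exec_instr (Load x a y) s = set_reg x (arr s a (reg s y)) s"
| "exec_instr (Store a x y) s =
     s\<lparr>arr := (arr s)(a := (arr s a)(reg s x := reg s y))\<rparr>"

datatype program =
    Skip
  | Do instr
  | Seq program program
  | Cond test program program
  | While test program

text \<open>\<open>exec P s t s'\<close>: started in \<open>s\<close>, \<open>P\<close> halts in \<open>s'\<close> after exactly \<open>t\<close> steps.\<close>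

inductive exec :: "program \<Rightarrow> state \<Rightarrow> nat \<Rightarrow> state \<Rightarrow> bool" where
  Skip: "exec Skip s 1 s"
| Do: "exec (Do i) s 1 (exec_instr i s)"
| Seq: "exec P s t s' \<Longrightarrow> exec Q s' u s'' \<Longrightarrow> exec (Seq P Q) s (t + u) s''"
| CondT: "holds b s \<Longrightarrow> exec P s t s' \<Longrightarrow> exec (Cond b P Q) s (1 + t) s'"
| CondF: "\<not> holds b s \<Longrightarrow> exec Q s t s' \<Longrightarrow> exec (Cond b P Q) s (1 + t) s'"
| WhileF: "\<not> holds b s \<Longrightarrow> exec (While b P) s 1 s"
| WhileT: "holds b s \<Longrightarrow> exec P s t s' \<Longrightarrow> exec (While b P) s' u s'' \<Longrightarrow>
    exec (While b P) s (1 + t + u) s''"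

lemma exec_deterministic:
  "exec P s t s' \<Longrightarrow> exec P s u s'' \<Longrightarrow> u = t \<and> s'' = s'"
proof (induction arbitrary: u s'' rule: exec.induct)
  case Skip
  from Skip.prems show ?case by cases simp
next
  case Do
  from Do.prems show ?case by cases simp
next
  case (Seq P s t s' Q v r)
  from Seq.prems show ?case by cases (metis Seq.IH)
next
  case (CondT b s P t s' Q)
  from CondT.prems show ?case by cases (metis CondT.IH, metis CondT.hyps(1))
next
  case (CondF b s Q t s' P)
  from CondF.prems show ?case by cases (metis CondF.hyps(1), metis CondF.IH)
next
  case (WhileF b s P)
  from WhileF.prems show ?case by cases (simp, metis WhileF.hyps(1))
next
  case (WhileT b s P t s' v r)
  from WhileT.prems show ?case by cases (metis WhileT.hyps(1), metis WhileT.IH)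
qed

text \<open>Registers and array cells that do not hold input are zero.\<close>

definition input_state :: "embedded_graph \<Rightarrow> state" where
  "input_state D =
     \<lparr>reg = (\<lambda>x. if x = 0 then num_nodes D else if x = 1 then num_darts D else 0),
      arr = (\<lambda>a i.
        if a = 0 \<and> i < num_nodes D then of_bool (crossing_node D i)
        else if a = 1 \<and> i < num_darts D then origin D i
        else if a = 2 \<and> i < num_darts D then twin D i
        else if a = 3 \<and> i < num_darts D then rot D i
        else 0)\<rparr>"

text \<open>
  The answer is 1 for success and 0 for failure. A coloring is output by giving, for each dart of
  the planarization, the color of the edge it belongs to.
\<close>

definition output_answer :: "state \<Rightarrow> nat" where
  "output_answer s = reg s 0"

definition output_color :: "state \<Rightarrow> nat \<Rightarrow> nat" where
  "output_color s d = arr s 4 d"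

end

theory Submission
  imports Defs
begin

text \<open>
  Say that two edges conflict if some third edge crosses both of them. A map from the edges to
  \<open>{1, 2}\<close> is a 1-plane 2-edge-coloring iff conflicting edges get different colors
  (\<open>coloring_iff_conflicts\<close>), so the task is to decide whether the conflict graph is bipartite.
  The drawing enters through the fact that an edge has at most two crossings. If \<open>f\<close> and \<open>g\<close>
  conflict because of \<open>e\<close>, then the crossings of \<open>e\<close> with \<open>f\<close> and with \<open>g\<close> are consecutive on
  \<open>e\<close>, so the conflict is seen in the planarization along a single piece of \<open>e\<close>.

  The planarization does not tell which darts belong to the same edge, so the unknowns of the
  algorithm are the colors of the darts. A dart has the same color as its twin and, at a crossing,
  as the dart opposite to it. The opposite dart is two rotation steps away, because the two
  edges alternate around a crossing (\<open>ccw_next_twice\<close>). If the rotation successor of a dart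
  lies on a piece between two crossings, a third constraint asks for a color different from that
  of the edge crossing at the other end of this piece. The exception is a pair of edges that
  cross each other twice: there both ends of the piece meet the same edge, which does not
  conflict with itself. It is recognized by following this edge to its other crossing
  (\<open>reaches_other_crossing_iff\<close>). These constraints hold for every valid coloring
  (\<open>constraint_same_edge\<close>, \<open>constraint_conflict\<close>), and they are enough: equality
  constraints connect all darts of an edge (\<open>same_edge_closed\<close>) and each conflict is expressed
  at some dart (\<open>conflict_constraint\<close>).

  A breadth-first search solves such a system. It starts each component with color 1, which
  loses nothing because swapping the two colors on a union of components preserves solutions, and
  from there on every color is forced, so that a violated constraint refutes all solutions. Each
  dart has at most three constraints and enters the queue once, and an edge contributes at most
  eight darts, since its curve has at most four stops; hence the running time is linear.
\<close>

section \<open>Programs and their running time\<close>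

fun loop_free :: "program \<Rightarrow> bool" where
  "loop_free Skip \<longleftrightarrow> True"
| "loop_free (Do i) \<longleftrightarrow> True"
| "loop_free (Seq P Q) \<longleftrightarrow> loop_free P \<and> loop_free Q"
| "loop_free (Cond b P Q) \<longleftrightarrow> loop_free P \<and> loop_free Q"
| "loop_free (While b P) \<longleftrightarrow> False"

text \<open>
  For programs without loops, execution is a total function and the running time is bounded by the
  number of instructions and tests, whatever branches are taken. The values of \<open>run\<close> and \<open>cost\<close>
  on loops are dummies.
\<close>

fun run :: "program \<Rightarrow> state \<Rightarrow> state" where
  "run Skip s = s"
| "run (Do i) s = exec_instr i s"
| "run (Seq P Q) s = run Q (run P s)"
| "run (Cond b P Q) s = (if holds b s then run P s else run Q s)"
| "run (While b P) s = s"

fun cost :: "program \<Rightarrow> nat" where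
  "cost Skip = 1"
| "cost (Do i) = 1"
| "cost (Seq P Q) = cost P + cost Q"
| "cost (Cond b P Q) = 1 + cost P + cost Q"
| "cost (While b P) = 0"

lemma exec_run: "loop_free P \<Longrightarrow> \<exists>t\<le>cost P. exec P s t (run P s)"
proof (induction P arbitrary: s)
  case Skip
  show ?case using exec.Skip by force
next
  case (Do i)
  show ?case using exec.Do by force
next
  case (Seq P Q)
  then obtain t u where "t \<le> cost P" "exec P s t (run P s)"
    "u \<le> cost Q" "exec Q (run P s) u (run Q (run P s))" by (metis loop_free.simps(3))
  then show ?case by (auto intro!: exI[of _ "t + u"] exec.Seq)
next
  case (Cond b P Q)
  show ?case
  proof (cases "holds b s")
    case True
    obtain t where "t \<le> cost P" "exec P s t (run P s)" using Cond by auto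
    then show ?thesis using True by (auto intro!: exI[of _ "1 + t"] exec.CondT[simplified])
  next
    case False
    obtain t where "t \<le> cost Q" "exec Q s t (run Q s)" using Cond by auto
    then show ?thesis using False by (auto intro!: exI[of _ "1 + t"] exec.CondF[simplified])
  qed
qed auto

lemma exec_While:
  assumes "loop_free P" and "I s"
    and "\<And>s. I s \<Longrightarrow> holds b s \<Longrightarrow> I (run P s) \<and> m (run P s) < (m s :: nat)"
  shows "\<exists>t s'. exec (While b P) s t s' \<and> t \<le> 1 + (1 + cost P) * m s \<and> I s' \<and> \<not> holds b s'"
  using assms(2)
proof (induction "m s" arbitrary: s rule: less_induct)
  case less
  show ?case
  proof (cases "holds b s")
    case False
    then show ?thesis using less.prems exec.WhileF by force
  next
    case True
    have 1: "I (run P s)" "m (run P s) < m s" using assms(3) less.prems True by auto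
    then obtain u s' where u: "exec (While b P) (run P s) u s'"
      "u \<le> 1 + (1 + cost P) * m (run P s)" "I s'" "\<not> holds b s'" using less.hyps by blast
    obtain t where t: "t \<le> cost P" "exec P s t (run P s)" using exec_run assms(1) by blast
    have "(1 + cost P) * (1 + m (run P s)) \<le> (1 + cost P) * m s"
      using 1(2) by (intro mult_le_mono) auto
    then have "1 + t + u \<le> 1 + (1 + cost P) * m s" using t u(2) by (simp add: algebra_simps)
    then show ?thesis using exec.WhileT[OF True t(2) u(1)] u by blast
  qed
qed

section \<open>Propagating colors along parity constraints\<close>

definition is_crossing :: "embedded_graph \<Rightarrow> nat \<Rightarrow> bool" where
  "is_crossing D x \<longleftrightarrow> crossing_node D (origin D x)"

text \<open>
  Let \<open>x\<close> be a dart at a crossing of its edge \<open>f\<close> with an edge \<open>e\<close>, and let the piece of \<open>e\<close>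
  that leaves along \<open>rot D x\<close> end at a crossing \<open>q\<close>. The condition says that one of the two pieces
  of \<open>f\<close> at this crossing ends at \<open>q\<close> as well, so that \<open>e\<close> and \<open>f\<close> cross twice.
\<close>

definition reaches_other_crossing :: "embedded_graph \<Rightarrow> nat \<Rightarrow> bool" where
  "reaches_other_crossing D x \<longleftrightarrow>
     origin D (twin D x) = origin D (twin D (rot D x)) \<or>
     origin D (twin D (rot D (rot D x))) = origin D (twin D (rot D x))"

text \<open>
  A pair \<open>(y, b)\<close> in \<open>constraints D x\<close> demands that \<open>x\<close> and \<open>y\<close> differ in color iff \<open>b\<close>. Although the
  constraints between edges are symmetric, the sets are not: a conflict between two edges is
  listed for only some of their darts.
\<close>

definition constraints :: "embedded_graph \<Rightarrow> nat \<Rightarrow> (nat \<times> bool) set" where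
  "constraints D x =
     {(twin D x, False)} \<union>
     (if is_crossing D x then {(rot D (rot D x), False)} else {}) \<union>
     (if is_crossing D x \<and> is_crossing D (twin D (rot D x)) \<and> \<not> reaches_other_crossing D x
      then {(rot D (twin D (rot D x)), True)} else {})"

definition closed_under :: "embedded_graph \<Rightarrow> nat set \<Rightarrow> bool" where
  "closed_under D S \<longleftrightarrow> (\<forall>x\<in>S. \<forall>(y, b)\<in>constraints D x. y \<in> S)"

definition solution :: "embedded_graph \<Rightarrow> (nat \<Rightarrow> nat) \<Rightarrow> bool" where
  "solution D \<psi> \<longleftrightarrow>
     (\<forall>x<num_darts D. \<psi> x \<in> {1, 2} \<and> (\<forall>(y, b)\<in>constraints D x. \<psi> y \<noteq> \<psi> x \<longleftrightarrow> b))"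

text \<open>
  Array 4 holds the colors, with 0 for darts not colored yet, and array 5 the queue, whose head and
  tail are registers 3 and 4. The color array thus also serves as the set of darts that were ever
  in the queue. Register 2 runs through the possible start darts; registers 5 and 6 hold the dart
  taken from the queue and its color, register 10 the other color, register 7 the dart being visited.
  Registers 9 and 15 hold the rotation successor \<open>u\<close> of the current dart and the twin of \<open>u\<close>, and
  register 16 the node at which this twin starts. Registers 8 and 12 contain the constants 0 and 1;
  the others are scratch. Register 0 is the answer, which a violated constraint sets to 0.
\<close>

notation Seq (infixr \<open>;;\<close> 55)

lemma solutionD:
  assumes "solution D \<psi>" "x < num_darts D"
  shows "\<psi> x \<in> {1, 2}" "(y, b) \<in> constraints D x \<Longrightarrow> \<psi> y \<noteq> \<psi> x \<longleftrightarrow> b"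
  using assms unfolding solution_def by blast+

definition visit :: "nat \<Rightarrow> program" where
  "visit r =
     Do (Load 13 4 7) ;;
     Cond (Equal 13 8)
       (Do (Store 4 7 r) ;; Do (Store 5 4 7) ;; Do (Inc 4))
       (Cond (Equal 13 r) Skip (Do (Const 0 0)))"

definition propagate_difference :: program where
  "propagate_difference =
     Do (Load 17 2 5) ;; Do (Load 17 1 17) ;;
     Cond (Equal 17 16) Skip
       (Do (Load 17 3 9) ;; Do (Load 17 2 17) ;; Do (Load 17 1 17) ;;
        Cond (Equal 17 16) Skip
          (Do (Load 7 3 15) ;; visit 10))"

definition propagate_at_crossing :: program where
  "propagate_at_crossing =
     Do (Load 9 3 5) ;; Do (Load 7 3 9) ;; visit 6 ;;
     Do (Load 15 2 9) ;; Do (Load 16 1 15) ;; Do (Load 14 0 16) ;;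
     Cond (Equal 14 8) Skip propagate_difference"

definition propagate :: program where
  "propagate =
     Do (Load 7 2 5) ;; visit 6 ;;
     Do (Load 14 1 5) ;; Do (Load 14 0 14) ;;
     Cond (Equal 14 8) Skip propagate_at_crossing"

text \<open>
  Taking a dart from the queue, starting a new component, and advancing the start dart are
  alternatives of a single loop body, so that the program needs no nested loops.
\<close>

definition step :: program where
  "step =
     Cond (Less 3 4)
       (Do (Load 5 5 3) ;; Do (Inc 3) ;; Do (Load 6 4 5) ;;
        Cond (Equal 6 12) (Do (Const 10 2)) (Do (Const 10 1)) ;;
        propagate)
       (Do (Load 13 4 2) ;;
        Cond (Equal 13 8)
          (Do (Store 4 2 12) ;; Do (Store 5 4 2) ;; Do (Inc 4))
          (Do (Inc 2)))"

definition color_darts :: program where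
  "color_darts = Do (Const 0 1) ;; Do (Const 12 1) ;; While (Less 2 1) step"

text \<open>
  \<open>closed_complement\<close> is the form of symmetry of the constraints that the search needs. It permits
  each constraint to be listed from one of its ends only, as long as the connected components are
  the same in both directions.
\<close>

locale rotation_system =
  fixes D :: embedded_graph
  assumes origin_less: "d < num_darts D \<Longrightarrow> origin D d < num_nodes D"
    and twin_less: "d < num_darts D \<Longrightarrow> twin D d < num_darts D"
    and rot_less: "d < num_darts D \<Longrightarrow> rot D d < num_darts D"
    and closed_complement:
      "S \<subseteq> {..<num_darts D} \<Longrightarrow> closed_under D S \<Longrightarrow> closed_under D ({..<num_darts D} - S)"
begin

lemma constraints_less: "x < num_darts D \<Longrightarrow> (y, b) \<in> constraints D x \<Longrightarrow> y < num_darts D"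
  by (auto simp: constraints_def twin_less rot_less split: if_splits)

text \<open>
  No constraint joins a closed set to its complement, so colors may be swapped on the complement.
\<close>

lemma solution_flip:
  assumes "solution D \<psi>" "S \<subseteq> {..<num_darts D}" "closed_under D S"
  shows "solution D (\<lambda>x. if x \<in> S then \<psi> x else 3 - \<psi> x)"
  unfolding solution_def
proof (intro allI impI conjI ballI)
  fix x assume x: "x < num_darts D"
  have 2: "\<psi> z = 1 \<or> \<psi> z = 2" if "z < num_darts D" for z
    using assms(1) that by (auto simp: solution_def)
  show "(if x \<in> S then \<psi> x else 3 - \<psi> x) \<in> {1, 2}" using 2[OF x] by auto
  fix yb assume yb: "yb \<in> constraints D x"
  obtain y b where yb': "yb = (y, b)" by force
  have c: "\<psi> y \<noteq> \<psi> x \<longleftrightarrow> b" using assms(1) x yb yb' by (auto simp: solution_def)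
  have y: "y < num_darts D" using yb yb' x constraints_less by auto
  have "y \<in> S \<longleftrightarrow> x \<in> S"
    using assms(3) closed_complement[OF assms(2,3)] x y yb yb' unfolding closed_under_def by fastforce
  then show "case yb of (y, b) \<Rightarrow>
      ((if y \<in> S then \<psi> y else 3 - \<psi> y) \<noteq> (if x \<in> S then \<psi> x else 3 - \<psi> x)) = b"
    using c yb' 2[OF x] 2[OF y] by auto
qed

abbreviation colored :: "state \<Rightarrow> nat set" where
  "colored s \<equiv> {x. arr s 4 x \<noteq> 0}"

text \<open>
  The central invariant: the queue lists the colored darts without repetition, the answer 0 is
  justified, and the colors chosen so far are part of a solution if there is any.
\<close>

definition extendable :: "state \<Rightarrow> bool" where
  "extendable s \<longleftrightarrow>
     inj_on (arr s 5) {..<reg s 4} \<and> arr s 5 ` {..<reg s 4} = colored s \<and>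
     colored s \<subseteq> {..<num_darts D} \<and> (\<forall>x. arr s 4 x \<le> 2) \<and>
     reg s 0 \<le> 1 \<and> (reg s 0 = 0 \<longrightarrow> (\<nexists>\<psi>. solution D \<psi>)) \<and>
     ((\<exists>\<psi>. solution D \<psi>) \<longrightarrow> (\<exists>\<psi>. solution D \<psi> \<and> (\<forall>x\<in>colored s. \<psi> x = arr s 4 x)))"

definition input_data :: "state \<Rightarrow> bool" where
  "input_data s \<longleftrightarrow> (\<forall>a<4. arr s a = arr (input_state D) a) \<and>
     reg s 1 = num_darts D \<and> reg s 8 = 0 \<and> reg s 12 = 1"

definition checked :: "state \<Rightarrow> nat \<Rightarrow> nat \<times> bool \<Rightarrow> bool" where
  "checked s x = (\<lambda>(y, b). arr s 4 y \<noteq> 0 \<and> (reg s 0 = 1 \<longrightarrow> (arr s 4 y \<noteq> arr s 4 x \<longleftrightarrow> b)))"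

text \<open>
  Colors and queue entries are never changed once written, so checked constraints remain checked.
\<close>

definition extends :: "state \<Rightarrow> state \<Rightarrow> bool" where
  "extends s s' \<longleftrightarrow>
     (\<forall>z\<in>colored s. arr s' 4 z = arr s 4 z) \<and>
     (\<forall>i<reg s 4. arr s' 5 i = arr s 5 i) \<and>
     reg s 4 \<le> reg s' 4 \<and> reg s' 0 \<le> reg s 0"

lemma extends_refl: "extends s s" by (auto simp: extends_def)

lemma extends_trans: "extends s s' \<Longrightarrow> extends s' s'' \<Longrightarrow> extends s s''"
  unfolding extends_def by (auto dest: order_trans) 

lemma checked_extends:
  assumes "extends s s'" "extendable s" "checked s x yb" "arr s 4 x \<noteq> 0"
  shows "checked s' x yb"
proof -
  have "reg s 0 = 1" if "reg s' 0 = 1"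
    using assms(1,2) that by (auto simp: extends_def extendable_def)
  then show ?thesis using assms by (auto simp: checked_def extends_def split: prod.splits)
qed

lemma tail_card: "extendable s \<Longrightarrow> reg s 4 = card (colored s)"
  unfolding extendable_def by (metis card_image card_lessThan)

lemma tail_le: "extendable s \<Longrightarrow> reg s 4 \<le> num_darts D"
  by (metis tail_card card_lessThan card_mono extendable_def finite_lessThan)

lemma extendableD:
  assumes "extendable s"
  shows "j < reg s 4 \<Longrightarrow> arr s 4 (arr s 5 j) \<noteq> 0"
    and "arr s 4 x \<noteq> 0 \<Longrightarrow> \<exists>j<reg s 4. arr s 5 j = x"
    and "arr s 4 x \<noteq> 0 \<Longrightarrow> x < num_darts D"
    and "arr s 4 x \<noteq> 0 \<Longrightarrow> arr s 4 x \<in> {1, 2}"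
proof -
  have im: "arr s 5 ` {..<reg s 4} = colored s" and sub: "colored s \<subseteq> {..<num_darts D}"
    and le: "arr s 4 x \<le> 2"
    using assms unfolding extendable_def by blast+
  show "j < reg s 4 \<Longrightarrow> arr s 4 (arr s 5 j) \<noteq> 0" using im by blast
  show "\<exists>j<reg s 4. arr s 5 j = x" if "arr s 4 x \<noteq> 0"
  proof -
    have "x \<in> arr s 5 ` {..<reg s 4}" unfolding im using that by simp
    then show ?thesis by blast
  qed
  show "arr s 4 x \<noteq> 0 \<Longrightarrow> x < num_darts D" using sub by blast
  show "arr s 4 x \<noteq> 0 \<Longrightarrow> arr s 4 x \<in> {1, 2}" using le by auto
qed

lemma extendable_cong:
  "arr s' 4 = arr s 4 \<Longrightarrow> arr s' 5 = arr s 5 \<Longrightarrow> reg s' 4 = reg s 4 \<Longrightarrow> reg s' 0 = reg s 0 \<Longrightarrow>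
   extendable s' = extendable s"
  by (simp add: extendable_def)

lemma extendable_fail:
  assumes "extendable s" "\<nexists>\<psi>. solution D \<psi>"
    and "arr s' 4 = arr s 4" "arr s' 5 = arr s 5" "reg s' 4 = reg s 4" "reg s' 0 = 0"
  shows "extendable s'"
proof -
  have "\<not> (\<exists>\<psi>. solution D \<psi>)" using assms(2) .
  then show ?thesis using assms(1) unfolding extendable_def assms(3-6) by (elim conjE) (intro conjI, auto)
qed

text \<open>
  Coloring one more dart keeps the invariant if every solution can be replaced by one that agrees
  with the enlarged coloring. The premise is met when the color is forced by a constraint, and also
  at the start of a component by swapping colors.
\<close>

lemma extendable_insert:
  assumes "extendable s" "arr s 4 y = 0" "y < num_darts D" "k \<in> {1, 2}"
    and "\<And>\<psi>. solution D \<psi> \<Longrightarrow> \<exists>\<psi>. solution D \<psi> \<and> (\<forall>x\<in>colored s. \<psi> x = arr s 4 x) \<and> \<psi> y = k"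
    and s': "arr s' 4 = (arr s 4)(y := k)" "arr s' 5 = (arr s 5)(reg s 4 := y)"
      "reg s' 4 = Suc (reg s 4)" "reg s' 0 = reg s 0"
  shows "extendable s' \<and> extends s s'"
proof -
  have c: "colored s' = insert y (colored s)" using assms s' by auto
  have im: "arr s' 5 ` {..<reg s 4} = colored s"
    using assms(1) s' by (auto simp: extendable_def)
  have "inj_on (arr s' 5) {..<reg s 4}" using assms(1) s' by (auto simp: extendable_def inj_on_def)
  then have "inj_on (arr s' 5) {..<reg s' 4}"
    using im assms(2) s' by (auto simp: lessThan_Suc)
  moreover have "arr s' 5 ` {..<reg s' 4} = colored s'"
    unfolding c using im s' by (auto simp: lessThan_Suc)
  moreover have "\<exists>\<psi>. solution D \<psi> \<and> (\<forall>x\<in>colored s'. \<psi> x = arr s' 4 x)" if "\<exists>\<psi>. solution D \<psi>"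
    using assms(5) that assms(2) unfolding c s' by (metis fun_upd_apply insert_iff mem_Collect_eq)
  moreover have "colored s' \<subseteq> {..<num_darts D}" "\<forall>x. arr s' 4 x \<le> 2"
    "reg s' 0 \<le> 1" "reg s' 0 = 0 \<longrightarrow> (\<nexists>\<psi>. solution D \<psi>)"
    using assms(1,3,4) unfolding c by (auto simp: extendable_def s')
  ultimately have "extendable s'" unfolding extendable_def by blast
  moreover have "extends s s'" using assms(2) s' by (auto simp: extends_def)
  ultimately show ?thesis by blast
qed

text \<open>
  The state while the constraints of \<open>x\<close> are being processed, those in \<open>C\<close> already done, with \<open>s\<^sub>0\<close>
  as the state before the first of them.
\<close>

definition visited :: "state \<Rightarrow> nat \<Rightarrow> (nat \<times> bool) set \<Rightarrow> state \<Rightarrow> bool" where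
  "visited s\<^sub>0 x C s \<longleftrightarrow>
     extendable s \<and> extends s\<^sub>0 s \<and> input_data s \<and>
     reg s 2 = reg s\<^sub>0 2 \<and> reg s 3 = reg s\<^sub>0 3 \<and> reg s 5 = x \<and> x < num_darts D \<and>
     arr s 4 x \<noteq> 0 \<and> reg s 6 = arr s 4 x \<and> reg s 10 = 3 - arr s 4 x \<and>
     (\<forall>c\<in>C. checked s x c)"

lemma reg_set_reg: "reg (set_reg r k s) z = (if z = r then k else reg s z)"
  and arr_set_reg: "arr (set_reg r k s) = arr s"
  by (auto simp: set_reg_def)

lemma visited_set_reg:
  assumes "r \<in> {7, 9, 13, 14, 15, 16, 17}"
  shows "visited s\<^sub>0 x C (set_reg r k s) = visited s\<^sub>0 x C s"
proof -
  have r: "r \<noteq> 0" "r \<noteq> 1" "r \<noteq> 2" "r \<noteq> 3" "r \<noteq> 4" "r \<noteq> 5" "r \<noteq> 6" "r \<noteq> 8" "r \<noteq> 10" "r \<noteq> 12"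
    using assms by auto
  have "extendable (set_reg r k s) = extendable s" "extends s\<^sub>0 (set_reg r k s) = extends s\<^sub>0 s"
    "input_data (set_reg r k s) = input_data s" "checked (set_reg r k s) = checked s"
    using r[symmetric] by (simp_all add: extendable_def extends_def input_data_def checked_def
        reg_set_reg arr_set_reg fun_eq_iff del: One_nat_def)
  then show ?thesis using r[symmetric] by (simp add: visited_def reg_set_reg arr_set_reg del: One_nat_def)
qed

text \<open>
  In a solution that agrees with the coloring so far, the color of \<open>x\<close> and the constraint determine
  the color \<open>k\<close> of \<open>y\<close>. Hence \<open>k\<close> is the right choice if \<open>y\<close> has no color yet, and if \<open>y\<close> has
  another color, there is no solution.
\<close>

lemma visit_correct:
  assumes v: "visited s\<^sub>0 x C s" and y: "(y, b) \<in> constraints D x" "reg s 7 = y"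
    and r: "r = (if b then 10 else 6)"
  shows "visited s\<^sub>0 x (insert (y, b) C) (run (visit r) s) \<and>
    (\<forall>z. z \<notin> {0, 4, 13} \<longrightarrow> reg (run (visit r) s) z = reg s z)"
proof -
  define k where "k = reg s r"
  let ?s' = "run (visit r) s"
  note vd = v[unfolded visited_def]
  have ext: "extendable s" using vd by blast
  have xM: "x < num_darts D" and yM: "y < num_darts D" using vd y constraints_less by auto
  have x12: "arr s 4 x = 1 \<or> arr s 4 x = 2"
    using vd unfolding extendable_def by (metis One_nat_def le_0_eq le_Suc_eq numeral_2_eq_2)
  have k: "k \<in> {1, 2}" "k \<noteq> arr s 4 x \<longleftrightarrow> b" and kb: "\<And>j. j \<in> {1, 2} \<Longrightarrow> (j \<noteq> arr s 4 x \<longleftrightarrow> b) \<Longrightarrow> j = k"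
    using x12 vd r by (auto simp: k_def)
  have forced: "\<psi> y = k" if "solution D \<psi>" "\<forall>z\<in>colored s. \<psi> z = arr s 4 z" for \<psi>
  proof (rule kb)
    show "\<psi> y \<in> {1, 2}" using solutionD(1)[OF that(1) yM] .
    have "\<psi> x = arr s 4 x" using that(2) vd by blast
    then show "\<psi> y \<noteq> arr s 4 x \<longleftrightarrow> b" using solutionD(2)[OF that(1) xM y(1)] by simp
  qed
  have r8: "reg s 8 = 0" using vd by (auto simp: input_data_def)
  have frame: "\<forall>z. z \<notin> {0, 4, 13} \<longrightarrow> reg ?s' z = reg s z"
    using r by (auto simp: visit_def set_reg_def)
  have arrf: "\<forall>a<4. arr ?s' a = arr s a"
    using r by (auto simp: visit_def set_reg_def)
  have "extendable ?s' \<and> extends s ?s' \<and> checked ?s' x (y, b)"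
  proof (cases "arr s 4 y = 0")
    case True
    have s': "arr ?s' 4 = (arr s 4)(y := k)" "arr ?s' 5 = (arr s 5)(reg s 4 := y)"
      "reg ?s' 4 = Suc (reg s 4)" "reg ?s' 0 = reg s 0"
      using True r8 y(2) r by (auto simp: visit_def set_reg_def k_def)
    have "extendable ?s' \<and> extends s ?s'"
    proof (rule extendable_insert[OF ext True yM k(1) _ s'])
      fix \<psi> assume "solution D \<psi>"
      then obtain \<psi> where "solution D \<psi>" "\<forall>z\<in>colored s. \<psi> z = arr s 4 z"
        using ext unfolding extendable_def by blast
      then show "\<exists>\<psi>. solution D \<psi> \<and> (\<forall>z\<in>colored s. \<psi> z = arr s 4 z) \<and> \<psi> y = k"
        using forced by blast
    qed
    moreover have "checked ?s' x (y, b)" using k vd True by (auto simp: checked_def s')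
    ultimately show ?thesis by blast
  next
    case False
    have s': "arr ?s' = arr s" "reg ?s' 4 = reg s 4" "reg ?s' 0 = (if arr s 4 y = k then reg s 0 else 0)"
      using False r8 y(2) r by (auto simp: visit_def set_reg_def k_def)
    have "extendable ?s'"
    proof (cases "arr s 4 y = k")
      case True
      then show ?thesis using ext extendable_cong[of ?s' s] s' by simp
    next
      case neq: False
      have "\<nexists>\<psi>. solution D \<psi>"
      proof
        assume "\<exists>\<psi>. solution D \<psi>"
        then obtain \<psi> where "solution D \<psi>" "\<forall>z\<in>colored s. \<psi> z = arr s 4 z"
          using ext unfolding extendable_def by blast
        then show False using forced[of \<psi>] False neq by simp
      qed
      then show ?thesis using extendable_fail[OF ext, of ?s'] s' neq by simp
    qed
    moreover have "extends s ?s'" by (simp add: extends_def s')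
    moreover have "checked ?s' x (y, b)" using k False by (simp add: checked_def s')
    ultimately show ?thesis by blast
  qed
  then have e: "extendable ?s'" "extends s ?s'" "checked ?s' x (y, b)" by blast+
  have "input_data s" using vd by blast
  then have "input_data ?s'" unfolding input_data_def using arrf frame by simp
  moreover have "arr ?s' 4 x = arr s 4 x" using e(2) vd unfolding extends_def by blast
  moreover have "\<forall>c\<in>insert (y, b) C. checked ?s' x c"
    using checked_extends[OF e(2) ext] e(3) vd by blast
  moreover have "extends s\<^sub>0 ?s'" using e(2) vd extends_trans by blast
  ultimately have "visited s\<^sub>0 x (insert (y, b) C) ?s'"
    unfolding visited_def using vd frame e(1) by simp
  with frame show ?thesis by blast
qed

lemma input_arr:
  assumes "input_data s" "x < num_darts D"
  shows "arr s 1 x = origin D x" "arr s 2 x = twin D x" "arr s 3 x = rot D x"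
    "arr s 0 (origin D x) = of_bool (is_crossing D x)" "arr s (Suc 0) x = origin D x"
  using assms origin_less by (auto simp: input_data_def input_state_def is_crossing_def)

lemma propagate_correct:
  assumes v: "visited s\<^sub>0 x {} s"
  shows "visited s\<^sub>0 x (constraints D x) (run propagate s)"
proof -
  note sr = visited_set_reg reg_set_reg arr_set_reg
  have vD: "reg s 5 = x" "x < num_darts D" "input_data s" "reg s 8 = 0" if "visited s\<^sub>0 x C s" for C s
    using that by (auto simp: visited_def input_data_def)
  let ?y1 = "twin D x" and ?u = "rot D x"
  let ?y2 = "rot D ?u" and ?w = "twin D ?u"
  let ?y3 = "rot D ?w"
  have less: "x < num_darts D" "?y1 < num_darts D" "?u < num_darts D" "?y2 < num_darts D" "?w < num_darts D"
    "twin D ?y2 < num_darts D"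
    using vD[OF v] twin_less rot_less by auto
  define s1 where "s1 = run (visit 6) (set_reg 7 ?y1 s)"
  have s1: "visited s\<^sub>0 x {(?y1, False)} s1"
    unfolding s1_def using visit_correct[of s\<^sub>0 x "{}" "set_reg 7 ?y1 s" ?y1 False 6] v
    by (simp add: sr constraints_def)
  define s2 where "s2 = set_reg 14 (of_bool (is_crossing D x)) (set_reg 14 (origin D x) s1)"
  have s2: "visited s\<^sub>0 x {(?y1, False)} s2" "reg s2 14 = of_bool (is_crossing D x)"
    unfolding s2_def using s1 by (auto simp: sr)
  have "run propagate s = run (Cond (Equal 14 8) Skip propagate_at_crossing) s2"
    using vD[OF v] vD[OF s1] less
    by (simp add: propagate_def s2_def s1_def[symmetric] input_arr sr)
  then have run1: "run propagate s = (if is_crossing D x then run propagate_at_crossing s2 else s2)"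
    using s2 vD[OF s2(1)] by auto
  show ?thesis
  proof (cases "is_crossing D x")
    case False
    then show ?thesis using run1 s2 by (simp add: constraints_def)
  next
    case cx: True
    define s3 where "s3 = set_reg 7 ?y2 (set_reg 9 ?u s2)"
    have s3: "visited s\<^sub>0 x {(?y1, False)} s3" "reg s3 9 = ?u" "reg s3 7 = ?y2"
      unfolding s3_def using s2 by (auto simp: sr)
    define s4 where "s4 = run (visit 6) s3"
    have s4: "visited s\<^sub>0 x {(?y2, False), (?y1, False)} s4" "reg s4 9 = ?u"
      unfolding s4_def using visit_correct[OF s3(1), of ?y2 False 6] s3 cx by (simp_all add: constraints_def)
    define s5 where "s5 = set_reg 14 (of_bool (is_crossing D ?w)) (set_reg 16 (origin D ?w) (set_reg 15 ?w s4))"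
    have s5: "visited s\<^sub>0 x {(?y2, False), (?y1, False)} s5" "reg s5 9 = ?u"
      "reg s5 14 = of_bool (is_crossing D ?w)" "reg s5 16 = origin D ?w" "reg s5 15 = ?w"
      unfolding s5_def using s4 by (auto simp: sr)
    have "run propagate_at_crossing s2 = run (Cond (Equal 14 8) Skip propagate_difference) s5"
      using vD[OF s2(1)] vD[OF s4(1)] less s4
      by (simp add: propagate_at_crossing_def s5_def s4_def[symmetric] s3_def[symmetric] input_arr sr)
    then have run2: "run propagate_at_crossing s2 = (if is_crossing D ?w then run propagate_difference s5 else s5)"
      using s5 vD[OF s5(1)] by auto
    show ?thesis
    proof (cases "is_crossing D ?w")
      case False
      then show ?thesis using run1 run2 s5 cx by (simp add: constraints_def insert_commute)
    next
      case cw: True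
      define s6 where "s6 = set_reg 17 (origin D ?y1) (set_reg 17 ?y1 s5)"
      define s7 where "s7 = set_reg 17 (origin D (twin D ?y2)) (set_reg 17 (twin D ?y2) (set_reg 17 ?y2 s6))"
      have s6: "visited s\<^sub>0 x {(?y2, False), (?y1, False)} s6"
        unfolding s6_def using s5 by (auto simp: sr)
      have s7: "visited s\<^sub>0 x {(?y2, False), (?y1, False)} s7"
        unfolding s7_def using s6 by (auto simp: sr)
      have run3: "run propagate_difference s5 = (if origin D ?y1 = origin D ?w then s6
          else if origin D (twin D ?y2) = origin D ?w then s7 else run (visit 10) (set_reg 7 ?y3 s7))"
        using vD[OF s5(1)] vD[OF s6] vD[OF s7] less s5
        by (simp add: propagate_difference_def s7_def s6_def input_arr sr)
      show ?thesis
      proof (cases "reaches_other_crossing D x")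
        case True
        then show ?thesis using run1 run2 run3 s6 s7 cx cw
          by (auto simp: constraints_def reaches_other_crossing_def insert_commute)
      next
        case False
        have "(?y3, True) \<in> constraints D x" using cx cw False by (simp add: constraints_def)
        then have "visited s\<^sub>0 x (insert (?y3, True) {(?y2, False), (?y1, False)}) (run (visit 10) (set_reg 7 ?y3 s7))"
          using visit_correct[of s\<^sub>0 x "{(?y2, False), (?y1, False)}" "set_reg 7 ?y3 s7" ?y3 True 10] s7
          by (simp add: sr)
        then show ?thesis using run1 run2 run3 cx cw False
          by (simp add: constraints_def reaches_other_crossing_def insert_commute)
      qed
    qed
  qed
qed

text \<open>
  The last condition makes sure that the queue is empty when the last start dart has been passed.
\<close>

definition loop_invariant :: "state \<Rightarrow> bool" where
  "loop_invariant s \<longleftrightarrow>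
     extendable s \<and> input_data s \<and> reg s 3 \<le> reg s 4 \<and> reg s 2 \<le> num_darts D \<and>
     (\<forall>j<reg s 3. \<forall>c\<in>constraints D (arr s 5 j). checked s (arr s 5 j) c) \<and>
     (\<forall>x<reg s 2. arr s 4 x \<noteq> 0) \<and> (reg s 2 < num_darts D \<or> reg s 3 = reg s 4)"

text \<open>
  Each iteration takes a dart from the queue, adds one, or advances the start dart, and each of these
  happens at most once per dart.
\<close>

definition remaining :: "state \<Rightarrow> nat" where
  "remaining s = (num_darts D - reg s 2) + (num_darts D - reg s 3) + (num_darts D - reg s 4)"

lemma step_correct:
  assumes inv: "loop_invariant s" and "holds (Less 2 1) s"
  shows "loop_invariant (run step s) \<and> remaining (run step s) < remaining s"
proof -
  note li = inv[unfolded loop_invariant_def]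
  have ext: "extendable s" and inp: "input_data s" using li by auto
  have i: "reg s 2 < num_darts D" using assms(2) inp by (auto simp: input_data_def)
  have r: "reg s 8 = 0" "reg s 12 = 1" using inp by (auto simp: input_data_def)
  note t_le = tail_le[OF ext]
  consider "reg s 3 < reg s 4" | "reg s 3 = reg s 4" "arr s 4 (reg s 2) = 0"
    | "reg s 3 = reg s 4" "arr s 4 (reg s 2) \<noteq> 0" using li by linarith
  then show ?thesis
  proof cases
    case 1
    define x where "x = arr s 5 (reg s 3)"
    define s1 where "s1 = set_reg 10 (3 - arr s 4 x) (set_reg 6 (arr s 4 x) (set_reg 3 (Suc (reg s 3)) (set_reg 5 x s)))"
    have x: "arr s 4 x \<noteq> 0" using 1 extendableD(1)[OF ext] by (simp add: x_def)
    have x12: "arr s 4 x = 1 \<or> arr s 4 x = 2" using extendableD(4)[OF ext x] by blast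
    have xM: "x < num_darts D" using extendableD(3)[OF ext x] .
    have run: "run step s = run propagate s1"
      using 1 r x12 by (auto simp: step_def s1_def x_def reg_set_reg arr_set_reg)
    have "extendable s1" using ext extendable_cong[of s1 s] by (simp add: s1_def reg_set_reg arr_set_reg)
    moreover have "input_data s1" using inp by (simp add: input_data_def s1_def reg_set_reg arr_set_reg)
    moreover have "reg s1 5 = x" "reg s1 6 = arr s1 4 x" "reg s1 10 = 3 - arr s1 4 x" "arr s1 4 x \<noteq> 0"
      using x by (simp_all add: s1_def reg_set_reg arr_set_reg)
    ultimately have "visited s1 x {} s1" using xM extends_refl by (simp add: visited_def)
    then have v: "visited s1 x (constraints D x) (run step s)" using propagate_correct run by simp
    let ?s' = "run step s"
    have e1: "extends s ?s'" using v by (auto simp: visited_def extends_def s1_def reg_set_reg arr_set_reg)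
    have ext': "extendable ?s'" using v by (auto simp: visited_def)
    have q: "arr ?s' 5 j = arr s 5 j" if "j < reg s 4" for j using e1 that by (auto simp: extends_def)
    have r3: "reg ?s' 3 = Suc (reg s 3)" "reg ?s' 2 = reg s 2" using v by (auto simp: visited_def s1_def reg_set_reg)
    have chk: "\<forall>c\<in>constraints D (arr ?s' 5 j). checked ?s' (arr ?s' 5 j) c" if "j < reg ?s' 3" for j
    proof (cases "j = reg s 3")
      case True
      then show ?thesis using v q[of j] 1 by (auto simp: visited_def x_def)
    next
      case False
      then have j: "j < reg s 3" using that r3 by auto
      then have "arr s 4 (arr s 5 j) \<noteq> 0" using 1 extendableD(1)[OF ext] by simp
      moreover have "\<forall>c\<in>constraints D (arr s 5 j). checked s (arr s 5 j) c" using li j by blast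
      moreover have "arr ?s' 5 j = arr s 5 j" using q j 1 by simp
      ultimately show ?thesis using checked_extends[OF e1 ext] by simp
    qed
    have t: "reg s 4 \<le> reg ?s' 4" using e1 by (auto simp: extends_def)
    have "loop_invariant ?s'"
      unfolding loop_invariant_def
    proof (intro conjI)
      show "input_data ?s'" using v unfolding visited_def by blast
      show "\<forall>x<reg ?s' 2. arr ?s' 4 x \<noteq> 0" using li e1 r3 by (simp add: extends_def)
    qed (use ext' chk r3 1 t i in simp_all)
    moreover have "remaining ?s' < remaining s" using r3 t 1 t_le by (auto simp: remaining_def)
    ultimately show ?thesis by blast
  next
    case 2
    let ?i = "reg s 2" and ?s' = "run step s"
    have s': "arr ?s' 4 = (arr s 4)(?i := 1)" "arr ?s' 5 = (arr s 5)(reg s 4 := ?i)"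
      "reg ?s' 4 = Suc (reg s 4)" "reg ?s' 0 = reg s 0" "reg ?s' 2 = reg s 2" "reg ?s' 3 = reg s 3"
      using 2 r by (auto simp: step_def set_reg_def)
    have inp': "input_data ?s'" using inp 2 r by (auto simp: step_def set_reg_def input_data_def)
    have sub: "colored s \<subseteq> {..<num_darts D}" using ext by (auto simp: extendable_def)
    \<comment> \<open>the queue is empty, so the constraints of all colored darts have been checked\<close>
    have cl: "closed_under D (colored s)"
      unfolding closed_under_def
    proof
      fix x assume "x \<in> colored s"
      then obtain j where j: "j < reg s 3" "arr s 5 j = x" using extendableD(2)[OF ext] 2 by auto
      then have "\<forall>c\<in>constraints D x. checked s x c" using li by blast
      then show "\<forall>(y, b)\<in>constraints D x. y \<in> colored s" unfolding checked_def by blast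
    qed
    have "\<exists>\<psi>. solution D \<psi> \<and> (\<forall>x\<in>colored s. \<psi> x = arr s 4 x) \<and> \<psi> ?i = 1" if sol: "solution D \<psi>\<^sub>0" for \<psi>\<^sub>0
    proof -
      obtain \<psi> where \<psi>: "solution D \<psi>" "\<forall>x\<in>colored s. \<psi> x = arr s 4 x"
        using ext sol unfolding extendable_def by blast
      have "\<psi> ?i \<in> {1, 2}" using \<psi>(1) i by (auto simp: solution_def)
      then consider "\<psi> ?i = 1" | "\<psi> ?i = 2" by auto
      then show ?thesis
      proof cases
        case 1
        then show ?thesis using \<psi> by blast
      next
        case two: 2
        show ?thesis
          by (rule exI[of _ "\<lambda>x. if x \<in> colored s then \<psi> x else 3 - \<psi> x"])
            (use solution_flip[OF \<psi>(1) sub cl] \<psi>(2) two 2 in auto)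
      qed
    qed
    then have "extendable ?s' \<and> extends s ?s'"
      by (intro extendable_insert[OF ext 2(2) i _ _ s'(1-4)]) simp_all
    then have e: "extendable ?s'" "extends s ?s'" by blast+
    have t_le': "reg ?s' 4 \<le> num_darts D" using tail_le e by blast
    have "\<forall>c\<in>constraints D (arr ?s' 5 j). checked ?s' (arr ?s' 5 j) c" if "j < reg ?s' 3" for j
    proof -
      have j: "j < reg s 3" "j \<noteq> reg s 4" using that 2 by (simp_all add: s')
      then have "arr s 4 (arr s 5 j) \<noteq> 0" using 2 extendableD(1)[OF ext] by simp
      moreover have "\<forall>c\<in>constraints D (arr s 5 j). checked s (arr s 5 j) c" using li j by blast
      ultimately show ?thesis using j checked_extends[OF e(2) ext] by (simp add: s')
    qed
    moreover have "\<forall>x<reg ?s' 2. arr ?s' 4 x \<noteq> 0" using li by (simp add: s')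
    ultimately have "loop_invariant ?s'" unfolding loop_invariant_def using e inp' 2 i by (simp add: s')
    moreover have "remaining ?s' < remaining s" using t_le' by (auto simp: remaining_def s')
    ultimately show ?thesis by blast
  next
    case 3
    let ?s' = "run step s"
    have s': "arr ?s' = arr s" "reg ?s' 4 = reg s 4" "reg ?s' 0 = reg s 0" "reg ?s' 2 = Suc (reg s 2)" "reg ?s' 3 = reg s 3"
      using 3 r by (auto simp: step_def set_reg_def)
    have inp': "input_data ?s'" using inp 3 r by (auto simp: step_def set_reg_def input_data_def)
    have "extendable ?s'" using ext extendable_cong[of ?s' s] s' by simp
    moreover have "checked ?s' = checked s" by (simp add: checked_def s' fun_eq_iff)
    moreover have "\<forall>x<reg ?s' 2. arr ?s' 4 x \<noteq> 0" using li 3 by (simp add: s' less_Suc_eq)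
    ultimately have "loop_invariant ?s'" unfolding loop_invariant_def using inp' 3 i li by (simp add: s')
    moreover have "remaining ?s' < remaining s" using i by (auto simp: remaining_def s')
    ultimately show ?thesis by blast
  qed
qed

theorem color_darts_correct:
  "\<exists>t s. exec color_darts (input_state D) t s \<and> t \<le> 3 + (1 + cost step) * (3 * num_darts D) \<and>
     (reg s 0 = 1 \<and> solution D (arr s 4) \<or> reg s 0 = 0 \<and> (\<nexists>\<psi>. solution D \<psi>))"
proof -
  define s1 where "s1 = set_reg 12 1 (set_reg 0 1 (input_state D))"
  have inv: "loop_invariant s1" "remaining s1 = 3 * num_darts D"
    by (auto simp: s1_def loop_invariant_def extendable_def input_data_def remaining_def reg_set_reg arr_set_reg input_state_def)
  have lf: "loop_free step" by (simp add: step_def propagate_def propagate_at_crossing_def propagate_difference_def visit_def)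
  obtain t s where ts: "exec (While (Less 2 1) step) s1 t s" "t \<le> 1 + (1 + cost step) * remaining s1"
    "loop_invariant s" "\<not> holds (Less 2 1) s"
    using exec_While[of step loop_invariant s1 "Less 2 1" remaining] lf inv(1) step_correct by blast
  have "exec color_darts (input_state D) (1 + (1 + t)) s"
    unfolding color_darts_def
    by (intro exec.Seq[OF exec.Do]) (use ts(1) in \<open>simp add: s1_def\<close>)
  moreover have "1 + (1 + t) \<le> 3 + (1 + cost step) * (3 * num_darts D)" using ts(2) inv(2) by simp
  moreover have "reg s 0 = 1 \<and> solution D (arr s 4) \<or> reg s 0 = 0 \<and> (\<nexists>\<psi>. solution D \<psi>)"
  proof (cases "reg s 0 = 0")
    case True
    then show ?thesis using ts(3) unfolding loop_invariant_def extendable_def by blast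
  next
    case False
    note li = ts(3)[unfolded loop_invariant_def]
    have ext: "extendable s" using li by blast
    have 0: "reg s 0 = 1" using False li unfolding extendable_def by linarith
    have fin: "reg s 2 = num_darts D" "reg s 3 = reg s 4" using ts(4) li by (auto simp: input_data_def)
    have "solution D (arr s 4)" unfolding solution_def
    proof (intro allI impI conjI)
      fix x assume x: "x < num_darts D"
      have c: "arr s 4 x \<noteq> 0" using li fin x by simp
      then show "arr s 4 x \<in> {1, 2}" using extendableD(4)[OF ext] by blast
      obtain j where "j < reg s 3" "arr s 5 j = x" using extendableD(2)[OF ext c] fin by auto
      then have "\<forall>c\<in>constraints D x. checked s x c" using li by blast
      then show "\<forall>(y, b)\<in>constraints D x. arr s 4 y \<noteq> arr s 4 x \<longleftrightarrow> b"
        unfolding checked_def using 0 by blast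
    qed
    then show ?thesis using 0 by blast
  qed
  ultimately show ?thesis by blast
qed

end

section \<open>Cyclic order around a crossing\<close>

lemma ccw_angle_subtract:
  assumes "0 < ccw_angle a b" "ccw_angle a b \<le> ccw_angle a c"
  shows "ccw_angle b c = ccw_angle a c - ccw_angle a b"
proof -
  have "a \<noteq> 0" "b \<noteq> 0" "c \<noteq> 0" using assms by (auto simp: ccw_angle_def)
  then show ?thesis using Arg2pi_divide[of "b / a" "c / a"] assms by (simp add: ccw_angle_def)
qed

lemma ccw_angle_reverse:
  assumes "0 < ccw_angle a b"
  shows "ccw_angle b a = 2 * pi - ccw_angle a b"
proof -
  have "b / a \<notin> \<real> \<or> Arg2pi (b / a) = pi"
    using assms Arg2pi_eq_0_pi[of "b / a"] by (auto simp: ccw_angle_def)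
  then have "Arg2pi (inverse (b / a)) = 2 * pi - Arg2pi (b / a)"
    using Arg2pi_inverse[of "b / a"] by (auto simp del: inverse_divide)
  then show ?thesis by (simp add: ccw_angle_def)
qed

text \<open>
  With this, what \<open>crosses_at\<close> says about the order seen from one particular curve end holds as
  seen from each of the four ends.
\<close>

lemma ccw_order4_rotate:
  assumes "ccw_order4 a b c d"
  shows "ccw_order4 b c d a"
proof -
  have "ccw_angle a d < 2 * pi" by (simp add: ccw_angle_def Arg2pi_lt_2pi)
  then show ?thesis
    using assms ccw_angle_subtract[of a b c] ccw_angle_subtract[of a b d] ccw_angle_reverse[of a b]
    by (simp add: ccw_order4_def)
qed

section \<open>Crossings in a 2-plane drawing\<close>

text \<open>
  At a crossing, \<open>flip d\<close> is the dart opposite to \<open>d\<close>. It is not a dart at the end of an edge.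
\<close>

fun flip :: "dart \<Rightarrow> dart" where
  "flip (e, s, fwd) = (e, s, \<not> fwd)"

lemma dart_edge_flip [simp]: "dart_edge (flip d) = dart_edge d"
  and dart_node_flip [simp]: "dart_node \<Gamma> (flip d) = dart_node \<Gamma> d"
  and flip_flip [simp]: "flip (flip d) = d"
  and flip_neq [simp]: "flip d \<noteq> d"
  by (cases d; simp add: dart_edge_def)+

lemma dart_edge_rev [simp]: "dart_edge (dart_rev \<Gamma> G d) = dart_edge d"
  by (cases d) (simp add: dart_edge_def)

locale two_plane_drawing =
  fixes G :: ugraph and \<Gamma> :: drawing
  assumes simple: "simple_graph G" and drawing: "drawing_of \<Gamma> G" and two_plane: "k_plane 2 \<Gamma> G"
begin

abbreviation edge_image :: "nat set \<Rightarrow> complex set" where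
  "edge_image e \<equiv> path_image (curve \<Gamma> e)"

abbreviation vertex_points :: "complex set" where
  "vertex_points \<equiv> point \<Gamma> ` verts G"

definition crossings :: "nat set \<Rightarrow> complex set" where
  "crossings e = {p. \<exists>f\<in>edges G. f \<noteq> e \<and> crosses_at \<Gamma> e f p}"

definition conflict :: "nat set \<Rightarrow> nat set \<Rightarrow> bool" where
  "conflict f g \<longleftrightarrow> f \<in> edges G \<and> g \<in> edges G \<and> f \<noteq> g \<and>
     (\<exists>e\<in>edges G. e \<noteq> f \<and> e \<noteq> g \<and> (\<exists>p. crosses_at \<Gamma> e f p) \<and> (\<exists>p. crosses_at \<Gamma> e g p))"

lemma conflict_sym: "conflict f g \<Longrightarrow> conflict g f"
  unfolding conflict_def by blast

lemma finite_edges: "finite (edges G)"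
proof (rule finite_subset)
  show "edges G \<subseteq> Pow (verts G)" "finite (Pow (verts G))"
    using simple by (auto simp: simple_graph_def)
qed

lemma edge_arc: "e \<in> edges G \<Longrightarrow> arc (curve \<Gamma> e)"
  using drawing by (simp add: drawing_of_def)

lemma curve_inj:
  "e \<in> edges G \<Longrightarrow> s \<in> {0..1} \<Longrightarrow> t \<in> {0..1} \<Longrightarrow> curve \<Gamma> e s = curve \<Gamma> e t \<Longrightarrow> s = t"
  using edge_arc[of e] by (auto simp: arc_def inj_on_def)

lemma edge_ends:
  assumes "e \<in> edges G"
  shows "{curve \<Gamma> e 0, curve \<Gamma> e 1} = point \<Gamma> ` e" "e \<subseteq> verts G"
  using drawing simple assms by (auto simp: drawing_of_def pathstart_def pathfinish_def simple_graph_def)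

lemma ends_vertex_points:
  "e \<in> edges G \<Longrightarrow> curve \<Gamma> e 0 \<in> vertex_points" "e \<in> edges G \<Longrightarrow> curve \<Gamma> e 1 \<in> vertex_points"
  using edge_ends by blast+

lemma interior_not_vertex:
  assumes e: "e \<in> edges G" and s: "0 < s" "s < 1"
  shows "curve \<Gamma> e s \<notin> vertex_points"
proof
  assume "curve \<Gamma> e s \<in> vertex_points"
  then obtain v where v: "v \<in> verts G" "curve \<Gamma> e s = point \<Gamma> v" by blast
  have "curve \<Gamma> e s \<in> edge_image e" using s by (auto simp: path_image_def)
  then have "v \<in> e" using drawing e v by (auto simp: drawing_of_def)
  then have "curve \<Gamma> e s \<in> {curve \<Gamma> e 0, curve \<Gamma> e 1}" using edge_ends(1)[OF e] v by auto
  then show False using curve_inj[OF e, of s 0] curve_inj[OF e, of s 1] s by auto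
qed

lemma crossing_interior:
  assumes "crosses_at \<Gamma> e f p"
  shows "\<exists>s. 0 < s \<and> s < 1 \<and> curve \<Gamma> e s = p" "\<exists>t. 0 < t \<and> t < 1 \<and> curve \<Gamma> f t = p"
proof -
  obtain s t where "s \<in> {0<..<1}" "t \<in> {0<..<1}" "curve \<Gamma> e s = p" "curve \<Gamma> f t = p"
    using assms unfolding crosses_at_def by blast
  then show "\<exists>s. 0 < s \<and> s < 1 \<and> curve \<Gamma> e s = p" "\<exists>t. 0 < t \<and> t < 1 \<and> curve \<Gamma> f t = p"
    by auto
qed

lemma crossing_on_edges:
  "crosses_at \<Gamma> e f p \<Longrightarrow> p \<in> edge_image e" "crosses_at \<Gamma> e f p \<Longrightarrow> p \<in> edge_image f"
  by (force simp: path_image_def dest: crossing_interior)+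

lemma crossing_not_vertex:
  "e \<in> edges G \<Longrightarrow> crosses_at \<Gamma> e f p \<Longrightarrow> p \<notin> vertex_points"
  using interior_not_vertex crossing_interior(1) by metis

text \<open>
  Everything about crossings is reduced to points that lie on two edges: the drawing conditions are
  symmetric in the two edges, whereas \<open>crosses_at\<close> is not obviously so.
\<close>

lemma common_point_crossing:
  assumes "e \<in> edges G" "f \<in> edges G" "e \<noteq> f" "p \<in> edge_image e" "p \<in> edge_image f" "p \<notin> vertex_points"
  shows "crosses_at \<Gamma> e f p"
proof -
  have "p \<in> point \<Gamma> ` (e \<inter> f) \<or> crosses_at \<Gamma> e f p"
    using drawing assms unfolding drawing_of_def by blast
  moreover have "point \<Gamma> ` (e \<inter> f) \<subseteq> vertex_points" using edge_ends(2)[OF assms(1)] by blast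
  ultimately show ?thesis using assms(6) by blast
qed

lemma crosses_at_sym:
  "e \<in> edges G \<Longrightarrow> f \<in> edges G \<Longrightarrow> e \<noteq> f \<Longrightarrow> crosses_at \<Gamma> e f p \<Longrightarrow> crosses_at \<Gamma> f e p"
  using common_point_crossing[of f e p] crossing_on_edges crossing_not_vertex by blast

lemma at_most_two_edges:
  assumes "e \<in> edges G" "f \<in> edges G" "g \<in> edges G" "e \<noteq> f"
    and "p \<in> edge_image e" "p \<in> edge_image f" "p \<in> edge_image g" "p \<notin> vertex_points"
  shows "g = e \<or> g = f"
proof (rule ccontr)
  assume "\<not> (g = e \<or> g = f)"
  then have "card {e, f, g} = 3" using assms(4) by (simp add: card_insert_if) metis
  moreover have "{e, f, g} \<subseteq> {e \<in> edges G. p \<in> edge_image e}" using assms by auto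
  then have "card {e, f, g} \<le> card {e \<in> edges G. p \<in> edge_image e}"
    by (rule card_mono[rotated]) (use finite_edges in simp)
  moreover have "card {e \<in> edges G. p \<in> edge_image e} \<le> 2"
    using drawing assms(8) by (auto simp: drawing_of_def)
  ultimately show False by simp
qed

lemma crossings:
  assumes "e \<in> edges G"
  shows "finite (crossings e)" "card (crossings e) \<le> 2"
proof -
  have "crossings e \<subseteq> (\<Union>f\<in>edges G - {e}. edge_image e \<inter> edge_image f)"
    using crossing_on_edges by (auto simp: crossings_def)
  moreover have "finite (\<Union>f\<in>edges G - {e}. edge_image e \<inter> edge_image f)"
  proof (rule finite_UN_I)
    fix f assume "f \<in> edges G - {e}"
    then have "f \<in> edges G" "e \<noteq> f" by auto
    then show "finite (edge_image e \<inter> edge_image f)" using drawing assms unfolding drawing_of_def by blast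
  qed (use finite_edges in simp)
  ultimately show "finite (crossings e)" by (rule finite_subset)
  show "card (crossings e) \<le> 2" using two_plane assms by (simp add: k_plane_def crossings_def)
qed

lemma crossings_not_vertex: "e \<in> edges G \<Longrightarrow> p \<in> crossings e \<Longrightarrow> p \<notin> vertex_points"
  using crossing_not_vertex by (auto simp only: crossings_def)

lemma crossings_eq:
  assumes "e \<in> edges G" "p \<in> crossings e" "q \<in> crossings e" "p \<noteq> q"
  shows "crossings e = {p, q}"
  using card_seteq[of "crossings e" "{p, q}"] crossings[OF assms(1)] assms(2-4) by simp

lemma node_on_edge:
  assumes e: "e \<in> edges G" and p: "p \<in> nodes \<Gamma> G" "p \<in> edge_image e" "p \<notin> vertex_points"
  shows "p \<in> crossings e"
proof -
  obtain f g where fg: "f \<in> edges G" "g \<in> edges G" "f \<noteq> g" "crosses_at \<Gamma> f g p"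
    using p by (auto simp: nodes_def)
  then have "e = f \<or> e = g" using at_most_two_edges[of f g e p] crossing_on_edges p e by blast
  then show ?thesis using fg crosses_at_sym[of f g p] unfolding crossings_def by blast
qed

lemma interior_stop:
  assumes e: "e \<in> edges G" and "s \<in> stops \<Gamma> G e" "0 < s" "s < 1"
  shows "curve \<Gamma> e s \<in> crossings e"
  using node_on_edge[OF e] interior_not_vertex[OF e] assms by (auto simp: stops_def path_image_def)

lemma crossing_stop:
  assumes e: "e \<in> edges G" and p: "p \<in> crossings e"
  shows "\<exists>s\<in>stops \<Gamma> G e. 0 < s \<and> s < 1 \<and> curve \<Gamma> e s = p"
proof -
  obtain f where f: "f \<in> edges G" "f \<noteq> e" "crosses_at \<Gamma> e f p" using p by (auto simp: crossings_def)
  obtain s where s: "0 < s" "s < 1" "curve \<Gamma> e s = p" using crossing_interior(1)[OF f(3)] by blast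
  have "p \<in> nodes \<Gamma> G" using e f unfolding nodes_def by blast
  then show ?thesis using s by (intro bexI[of _ s]) (auto simp: stops_def)
qed

lemma end_stops: "e \<in> edges G \<Longrightarrow> 0 \<in> stops \<Gamma> G e" "e \<in> edges G \<Longrightarrow> 1 \<in> stops \<Gamma> G e"
  using ends_vertex_points by (auto simp: stops_def nodes_def)

lemma stops:
  assumes e: "e \<in> edges G"
  shows "finite (stops \<Gamma> G e)" "card (stops \<Gamma> G e) \<le> 4" "stops \<Gamma> G e \<subseteq> {0..1}"
proof -
  show sub: "stops \<Gamma> G e \<subseteq> {0..1}" by (auto simp: stops_def)
  let ?P = "insert (curve \<Gamma> e 0) (insert (curve \<Gamma> e 1) (crossings e))"
  have inj: "inj_on (curve \<Gamma> e) (stops \<Gamma> G e)"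
    using curve_inj[OF e] sub by (meson inj_onI subsetD)
  have im: "curve \<Gamma> e ` stops \<Gamma> G e \<subseteq> ?P"
  proof
    fix p assume "p \<in> curve \<Gamma> e ` stops \<Gamma> G e"
    then obtain s where s: "s \<in> stops \<Gamma> G e" "p = curve \<Gamma> e s" by blast
    then have "s = 0 \<or> s = 1 \<or> 0 < s \<and> s < 1" using sub by force
    then show "p \<in> ?P" using interior_stop[OF e s(1)] s(2) by auto
  qed
  have P: "finite ?P" "card ?P \<le> 4"
    using crossings[OF e] by (auto intro!: order_trans[OF card_insert_le_m1] simp: card_insert_if)
  show "finite (stops \<Gamma> G e)" using inj im P(1) by (metis finite_imageD finite_subset)
  show "card (stops \<Gamma> G e) \<le> 4" using card_inj_on_le[OF inj im P(1)] P(2) by simp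
qed

lemma card_darts_le: "card (darts \<Gamma> G) \<le> 8 * card (edges G)"
proof -
  have "darts \<Gamma> G \<subseteq> Sigma (edges G) (\<lambda>e. stops \<Gamma> G e \<times> UNIV)" by (auto simp: darts_def)
  moreover have "finite (Sigma (edges G) (\<lambda>e. stops \<Gamma> G e \<times> (UNIV :: bool set)))"
    using finite_edges stops(1) by auto
  ultimately have "card (darts \<Gamma> G) \<le> card (Sigma (edges G) (\<lambda>e. stops \<Gamma> G e \<times> (UNIV :: bool set)))"
    by (rule card_mono[rotated])
  also have "\<dots> = (\<Sum>e\<in>edges G. card (stops \<Gamma> G e) * 2)"
    using finite_edges stops(1) by (subst card_SigmaI) (auto simp: card_cartesian_product)
  also have "\<dots> \<le> (\<Sum>e\<in>edges G. 8)" using stops(2) by (intro sum_mono) fastforce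
  finally show ?thesis by simp
qed

section \<open>Darts at a crossing\<close>

lemma dart_cases:
  assumes "d \<in> darts \<Gamma> G"
  shows "dart_edge d \<in> edges G" "dart_node \<Gamma> d \<in> edge_image (dart_edge d)"
  using assms by (auto simp: darts_def dart_edge_def stops_def path_image_def)

lemma dart_interior:
  assumes "(e, s, b) \<in> darts \<Gamma> G" "curve \<Gamma> e s \<notin> vertex_points"
  shows "0 < s" "s < 1" "curve \<Gamma> e s \<in> crossings e"
proof -
  have e: "e \<in> edges G" "s \<in> stops \<Gamma> G e" using assms(1) by (auto simp: darts_def)
  then show "0 < s" "s < 1" using assms(2) ends_vertex_points stops(3)
    by (metis atLeastAtMost_iff less_eq_real_def subsetD)+
  then show "curve \<Gamma> e s \<in> crossings e" using interior_stop e by blast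
qed

lemma flip_dart:
  assumes "d \<in> darts \<Gamma> G" "dart_node \<Gamma> d \<notin> vertex_points"
  shows "flip d \<in> darts \<Gamma> G"
proof (cases d)
  case (fields e s b)
  then show ?thesis using assms dart_interior(1,2)[of e s b] by (auto simp: darts_def)
qed

lemma same_edge_same_node:
  assumes "d \<in> darts \<Gamma> G" "x \<in> darts \<Gamma> G" "dart_edge x = dart_edge d" "dart_node \<Gamma> x = dart_node \<Gamma> d"
  shows "x = d \<or> x = flip d"
proof -
  obtain e s b t c where dx: "d = (e, s, b)" "x = (e, t, c)"
    using assms(3) by (cases d; cases x) (auto simp: dart_edge_def)
  have "e \<in> edges G" "s \<in> {0..1}" "t \<in> {0..1}" using assms(1,2) dx by (auto simp: darts_def stops_def)
  then have "s = t" using curve_inj[of e s t] assms(4) dx by simp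
  then show ?thesis using dx by auto
qed

lemma dart_at_crossing:
  assumes "e \<in> edges G" "p \<in> crossings e"
  shows "\<exists>d\<in>darts \<Gamma> G. dart_edge d = e \<and> dart_node \<Gamma> d = p"
proof -
  obtain s where "s \<in> stops \<Gamma> G e" "0 < s" "s < 1" "curve \<Gamma> e s = p" using crossing_stop[OF assms] by blast
  then show ?thesis using assms(1) by (intro bexI[of _ "(e, s, True)"]) (auto simp: darts_def dart_edge_def)
qed

lemma other_dart:
  assumes "d \<in> darts \<Gamma> G" "dart_node \<Gamma> d \<notin> vertex_points"
  shows "\<exists>x\<in>darts \<Gamma> G. dart_edge x \<noteq> dart_edge d \<and> dart_node \<Gamma> x = dart_node \<Gamma> d"
proof -
  obtain e s b where d: "d = (e, s, b)" by (cases d)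
  have e: "e \<in> edges G" "dart_edge d = e" using assms(1) d by (auto simp: darts_def dart_edge_def)
  have "dart_node \<Gamma> d \<in> crossings e" using dart_interior(3)[of e s b] assms d by simp
  then obtain f where f: "f \<in> edges G" "f \<noteq> e" "crosses_at \<Gamma> e f (dart_node \<Gamma> d)" by (auto simp: crossings_def)
  then have "dart_node \<Gamma> d \<in> crossings f" using crosses_at_sym[of e f] e by (auto simp: crossings_def)
  then show ?thesis using dart_at_crossing[OF f(1)] f(2) e by metis
qed

lemma dart_edges_at_crossing:
  assumes "d \<in> darts \<Gamma> G" "x \<in> darts \<Gamma> G" "y \<in> darts \<Gamma> G" "dart_node \<Gamma> d \<notin> vertex_points"
    and "dart_node \<Gamma> x = dart_node \<Gamma> d" "dart_node \<Gamma> y = dart_node \<Gamma> d"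
    and "dart_edge x \<noteq> dart_edge d" "dart_edge y \<noteq> dart_edge x"
  shows "dart_edge y = dart_edge d"
  using at_most_two_edges[of "dart_edge d" "dart_edge x" "dart_edge y" "dart_node \<Gamma> d"] dart_cases assms by metis

text \<open>
  The definition of a crossing speaks about the forward darts of the two edges; rotating the cyclic
  order extends it to arbitrary directions.
\<close>

lemma darts_alternate:
  assumes x: "x \<in> darts \<Gamma> G" and y: "y \<in> darts \<Gamma> G" and xy: "dart_edge x \<noteq> dart_edge y"
    and nodes: "dart_node \<Gamma> x = dart_node \<Gamma> y" "dart_node \<Gamma> x \<notin> vertex_points"
  shows "\<forall>\<^sub>F r in at_right 0.
    ccw_order4 (dart_exit \<Gamma> x r) (dart_exit \<Gamma> y r) (dart_exit \<Gamma> (flip x) r) (dart_exit \<Gamma> (flip y) r) \<or>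
    ccw_order4 (dart_exit \<Gamma> x r) (dart_exit \<Gamma> (flip y) r) (dart_exit \<Gamma> (flip x) r) (dart_exit \<Gamma> y r)"
proof -
  obtain e s b f t c where d: "x = (e, s, b)" "y = (f, t, c)" by (cases x; cases y)
  have ef: "e \<in> edges G" "f \<in> edges G" "e \<noteq> f" "s \<in> {0..1}" "t \<in> {0..1}"
    using x y xy d by (auto simp: darts_def dart_edge_def stops_def)
  let ?p = "curve \<Gamma> e s"
  have p: "?p \<notin> vertex_points" "curve \<Gamma> f t = ?p" using nodes d by auto
  have "?p \<in> edge_image e" "?p \<in> edge_image f" using dart_cases(2)[OF x] dart_cases(2)[OF y] p(2) d by (auto simp: dart_edge_def)
  then have "crosses_at \<Gamma> e f ?p" using common_point_crossing ef p(1) by blast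
  then obtain s' t' where st: "s' \<in> {0<..<1}" "t' \<in> {0<..<1}" "curve \<Gamma> e s' = ?p" "curve \<Gamma> f t' = ?p"
    and ev: "\<forall>\<^sub>F r in at_right 0. let a  = exit_dir (curve \<Gamma> e) s' True r; a' = exit_dir (curve \<Gamma> e) s' False r;
               b  = exit_dir (curve \<Gamma> f) t' True r; b' = exit_dir (curve \<Gamma> f) t' False r
           in ccw_order4 a b a' b' \<or> ccw_order4 a b' a' b"
    unfolding crosses_at_def by blast
  have "s' = s" "t' = t" using curve_inj[OF ef(1), of s' s] curve_inj[OF ef(2), of t' t] ef st p by auto
  then show ?thesis using ev unfolding d Let_def
  proof (hypsubst, elim eventually_mono)
    fix r
    let ?a = "exit_dir (curve \<Gamma> e) s" and ?b = "exit_dir (curve \<Gamma> f) t"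
    assume o: "ccw_order4 (?a True r) (?b True r) (?a False r) (?b False r) \<or>
      ccw_order4 (?a True r) (?b False r) (?a False r) (?b True r)"
    then have "ccw_order4 (?a False r) (?b False r) (?a True r) (?b True r) \<or>
      ccw_order4 (?a False r) (?b True r) (?a True r) (?b False r)"
      using ccw_order4_rotate[OF ccw_order4_rotate] by blast
    with o show "ccw_order4 (dart_exit \<Gamma> (e, s, b) r) (dart_exit \<Gamma> (f, t, c) r)
        (dart_exit \<Gamma> (flip (e, s, b)) r) (dart_exit \<Gamma> (flip (f, t, c)) r) \<or>
      ccw_order4 (dart_exit \<Gamma> (e, s, b) r) (dart_exit \<Gamma> (flip (f, t, c)) r)
        (dart_exit \<Gamma> (flip (e, s, b)) r) (dart_exit \<Gamma> (f, t, c) r)"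
      by (cases b; cases c; simp; blast)
  qed
qed

lemma ccw_next_dart: "ccw_next \<Gamma> G d d' \<Longrightarrow> d' \<in> darts \<Gamma> G \<and> dart_node \<Gamma> d' = dart_node \<Gamma> d"
  by (simp add: ccw_next_def Let_def)

lemma ccw_next_least:
  assumes "ccw_next \<Gamma> G d d'" "x \<in> darts \<Gamma> G" "dart_node \<Gamma> x = dart_node \<Gamma> d" "x \<noteq> d"
  shows "d' \<noteq> d"
    and "\<forall>\<^sub>F r in at_right 0. ccw_angle (dart_exit \<Gamma> d r) (dart_exit \<Gamma> d' r)
              \<le> ccw_angle (dart_exit \<Gamma> d r) (dart_exit \<Gamma> x r)"
proof -
  have *: "\<forall>\<^sub>F r in at_right 0. d' \<noteq> d \<and> ccw_angle (dart_exit \<Gamma> d r) (dart_exit \<Gamma> d' r)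
              \<le> ccw_angle (dart_exit \<Gamma> d r) (dart_exit \<Gamma> x r)"
    using assms unfolding ccw_next_def Let_def by (auto elim!: eventually_mono)
  then show "\<forall>\<^sub>F r in at_right 0. ccw_angle (dart_exit \<Gamma> d r) (dart_exit \<Gamma> d' r)
              \<le> ccw_angle (dart_exit \<Gamma> d r) (dart_exit \<Gamma> x r)" by (rule eventually_mono) blast
  have "\<exists>r :: real. d' \<noteq> d" using eventually_happens[OF *] by auto
  then show "d' \<noteq> d" by blast
qed

text \<open>
  The opposite dart is never the successor, since the two darts of the other edge lie on either side
  of it.
\<close>

lemma ccw_next_other_edge:
  assumes d: "d \<in> darts \<Gamma> G" "dart_node \<Gamma> d \<notin> vertex_points" and n: "ccw_next \<Gamma> G d d'"
  shows "dart_edge d' \<noteq> dart_edge d"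
proof
  assume same: "dart_edge d' = dart_edge d"
  obtain x where x: "x \<in> darts \<Gamma> G" "dart_edge x \<noteq> dart_edge d" "dart_node \<Gamma> x = dart_node \<Gamma> d"
    using other_dart[OF d] by blast
  have x': "flip x \<in> darts \<Gamma> G" "flip x \<noteq> d" "x \<noteq> d" using flip_dart x d by auto
  have "d' = flip d"
    using same_edge_same_node[OF d(1), of d'] same ccw_next_dart[OF n] ccw_next_least(1)[OF n x(1,3)] x' by auto
  let ?x = "dart_exit \<Gamma>"
  have 1: "\<forall>\<^sub>F r in at_right 0. ccw_angle (?x d r) (?x (flip d) r) \<le> ccw_angle (?x d r) (?x x r)"
    using ccw_next_least(2)[OF n x(1,3) x'(3)] \<open>d' = flip d\<close> by simp
  have 2: "\<forall>\<^sub>F r in at_right 0. ccw_angle (?x d r) (?x (flip d) r) \<le> ccw_angle (?x d r) (?x (flip x) r)"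
    using ccw_next_least(2)[OF n x'(1) _ x'(2)] x(3) \<open>d' = flip d\<close> by simp
  have 3: "\<forall>\<^sub>F r in at_right 0. ccw_order4 (?x d r) (?x x r) (?x (flip d) r) (?x (flip x) r) \<or>
      ccw_order4 (?x d r) (?x (flip x) r) (?x (flip d) r) (?x x r)"
    using darts_alternate[OF d(1) x(1)] d x by metis
  have "\<forall>\<^sub>F r in at_right (0::real). False"
    using 1 2 3 by eventually_elim (auto simp: ccw_order4_def)
  then show False by simp
qed

text \<open>
  If the second step led back to \<open>d\<close>, then going counterclockwise from \<open>d'\<close> one would meet \<open>d\<close> before
  the dart opposite to \<open>d\<close>. But \<open>d'\<close> comes first after \<open>d\<close>, so \<open>flip d\<close> follows \<open>d'\<close> and \<open>d\<close> comes last.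
\<close>

lemma ccw_next_twice:
  assumes d: "d \<in> darts \<Gamma> G" "dart_node \<Gamma> d \<notin> vertex_points"
    and n: "ccw_next \<Gamma> G d d'" "ccw_next \<Gamma> G d' d''"
  shows "d'' = flip d"
proof -
  have d': "d' \<in> darts \<Gamma> G" "dart_node \<Gamma> d' = dart_node \<Gamma> d" "dart_edge d' \<noteq> dart_edge d"
    using ccw_next_dart[OF n(1)] ccw_next_other_edge[OF d n(1)] by auto
  have d'': "d'' \<in> darts \<Gamma> G" "dart_node \<Gamma> d'' = dart_node \<Gamma> d" "dart_edge d'' \<noteq> dart_edge d'"
    using ccw_next_dart[OF n(2)] ccw_next_other_edge[OF d'(1) _ n(2)] d d' by auto
  have "dart_edge d'' = dart_edge d" using dart_edges_at_crossing[OF d(1) d'(1) d''(1)] d d' d'' by simp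
  then have "d'' = d \<or> d'' = flip d" using same_edge_same_node[OF d(1) d''(1)] d'' by simp
  moreover have "d'' \<noteq> d"
  proof
    assume [simp]: "d'' = d"
    have f: "flip d \<in> darts \<Gamma> G" "flip d' \<in> darts \<Gamma> G"
      using flip_dart[OF d] flip_dart[OF d'(1)] d(2) d'(2) by simp_all
    have "flip d \<noteq> d'" "flip d' \<noteq> d" using d'(3) dart_edge_flip by metis+
    note f = f this
    let ?x = "dart_exit \<Gamma>"
    have 1: "\<forall>\<^sub>F r in at_right 0. ccw_angle (?x d r) (?x d' r) \<le> ccw_angle (?x d r) (?x (flip d') r)"
      using ccw_next_least(2)[OF n(1) f(2)] d' f by simp
    have 2: "\<forall>\<^sub>F r in at_right 0. ccw_angle (?x d' r) (?x d r) \<le> ccw_angle (?x d' r) (?x (flip d) r)"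
      using ccw_next_least(2)[OF n(2) f(1)] d' f by simp
    have 3: "\<forall>\<^sub>F r in at_right 0. ccw_order4 (?x d r) (?x d' r) (?x (flip d) r) (?x (flip d') r) \<or>
        ccw_order4 (?x d r) (?x (flip d') r) (?x (flip d) r) (?x d' r)"
      using darts_alternate[OF d(1) d'(1) d'(3)[symmetric] d'(2)[symmetric] d(2)] .
    have "\<forall>\<^sub>F r in at_right (0::real). False"
      using 1 2 3
    proof eventually_elim
      case (elim r)
      then have "ccw_order4 (?x d r) (?x d' r) (?x (flip d) r) (?x (flip d') r)"
        by (auto simp: ccw_order4_def)
      from ccw_order4_rotate[OF this] elim(2) show False by (simp add: ccw_order4_def)
    qed
    then show False by simp
  qed
  ultimately show ?thesis by blast
qed

section \<open>Darts along an edge\<close>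

lemma dart_rev_node_neq:
  assumes "d \<in> darts \<Gamma> G"
  shows "dart_node \<Gamma> (dart_rev \<Gamma> G d) \<noteq> dart_node \<Gamma> d"
proof -
  obtain e s b where d: "d = (e, s, b)" by (cases d)
  have e: "e \<in> edges G" "s \<in> stops \<Gamma> G e" using assms d by (auto simp: darts_def)
  obtain t where t: "t \<in> stops \<Gamma> G e" "t \<noteq> s" "dart_rev \<Gamma> G d = (e, t, \<not> b)"
  proof (cases b)
    case True
    let ?A = "{t \<in> stops \<Gamma> G e. s < t}"
    have "finite ?A" "1 \<in> ?A" using True assms d e stops(1) end_stops by (auto simp: darts_def)
    then have "Min ?A \<in> ?A" using Min_in[of ?A] by blast
    then show ?thesis using that[of "Min ?A"] True d by auto
  next
    case False
    let ?A = "{t \<in> stops \<Gamma> G e. t < s}"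
    have "finite ?A" "0 \<in> ?A" using False assms d e stops(1) end_stops by (auto simp: darts_def)
    then have "Max ?A \<in> ?A" using Max_in[of ?A] by blast
    then show ?thesis using that[of "Max ?A"] False d by auto
  qed
  have "s \<in> {0..1}" "t \<in> {0..1}" using stops(3)[OF e(1)] e(2) t(1) by blast+
  then show ?thesis using curve_inj[OF e(1), of t s] t(2,3) d by auto
qed

text \<open>
  With at most two crossings on an edge, its stops are the two ends and these crossings, so the two
  crossings are joined by a piece of the edge. A third crossing could separate them.
\<close>

lemma dart_rev_to_other_crossing:
  assumes d: "d \<in> darts \<Gamma> G" and pq: "dart_node \<Gamma> d \<in> crossings (dart_edge d)"
    "q \<in> crossings (dart_edge d)" "q \<noteq> dart_node \<Gamma> d"
  shows "dart_node \<Gamma> (dart_rev \<Gamma> G d) = q \<or> dart_node \<Gamma> (dart_rev \<Gamma> G (flip d)) = q"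
proof -
  obtain e s b where dd: "d = (e, s, b)" by (cases d)
  have e: "e \<in> edges G" "dart_edge d = e" "s \<in> stops \<Gamma> G e" using d dd by (auto simp: darts_def dart_edge_def)
  have cr: "crossings e = {curve \<Gamma> e s, q}" using crossings_eq[OF e(1)] pq e dd by simp
  have s: "0 < s" "s < 1"
  proof -
    have "curve \<Gamma> e s \<notin> vertex_points"
      using crossings_not_vertex[OF e(1)] pq(1) e(2) dd by simp
    then show "0 < s" "s < 1" using dart_interior[of e s b] d dd by auto
  qed
  obtain t where t: "t \<in> stops \<Gamma> G e" "0 < t" "t < 1" "curve \<Gamma> e t = q"
    using crossing_stop[OF e(1), of q] cr by blast
  have stops_eq: "stops \<Gamma> G e = {0, s, t, 1}"
  proof
    show "{0, s, t, 1} \<subseteq> stops \<Gamma> G e" using e t end_stops by auto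
    show "stops \<Gamma> G e \<subseteq> {0, s, t, 1}"
    proof
      fix u assume u: "u \<in> stops \<Gamma> G e"
      then have u01: "u \<in> {0..1}" using stops(3)[OF e(1)] by blast
      show "u \<in> {0, s, t, 1}"
      proof (cases "0 < u \<and> u < 1")
        case True
        then have "curve \<Gamma> e u \<in> {curve \<Gamma> e s, curve \<Gamma> e t}" using interior_stop[OF e(1) u] cr t by auto
        then show ?thesis using curve_inj[OF e(1) u01, of s] curve_inj[OF e(1) u01, of t] s t by auto
      qed (use u01 in auto)
    qed
  qed
  have "s \<noteq> t" using t pq(3) dd by auto
  then consider "s < t" | "t < s" by linarith
  then show ?thesis
  proof cases
    case 1
    have "{u \<in> stops \<Gamma> G e. s < u} = {t, 1}" using 1 s t by (auto simp: stops_eq)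
    then have "Min {u \<in> stops \<Gamma> G e. s < u} = t" using t by simp
    then show ?thesis using t dd by (cases b) auto
  next
    case 2
    have "{u \<in> stops \<Gamma> G e. u < s} = {0, t}" using 2 s t by (auto simp: stops_eq)
    then have "Max {u \<in> stops \<Gamma> G e. u < s} = t" using t by simp
    then show ?thesis using t dd by (cases b) auto
  qed
qed

text \<open>
  The darts of an edge are connected by reversal, and by passing to the opposite dart at crossings.
  The proof walks from the stop of \<open>x\<close> through the consecutive stops in both directions.
\<close>

lemma dart_edge_induct:
  assumes start: "x \<in> darts \<Gamma> G" "P x"
    and rev: "\<And>d. d \<in> darts \<Gamma> G \<Longrightarrow> P d \<Longrightarrow> P (dart_rev \<Gamma> G d)"
    and flip: "\<And>d. d \<in> darts \<Gamma> G \<Longrightarrow> dart_node \<Gamma> d \<notin> vertex_points \<Longrightarrow> P d \<Longrightarrow> P (flip d)"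
    and y: "y \<in> darts \<Gamma> G" "dart_edge y = dart_edge x"
  shows "P y"
proof -
  obtain e s b where x: "x = (e, s, b)" by (cases x)
  have e: "e \<in> edges G" and s: "s \<in> stops \<Gamma> G e" using start x by (auto simp: darts_def)
  note fin = stops(1)[OF e]
  define Q where "Q t \<longleftrightarrow> (\<forall>c. (e, t, c) \<in> darts \<Gamma> G \<longrightarrow> P (e, t, c))" for t
  have Q: "Q t" if "P (e, t, c)" "(e, t, c) \<in> darts \<Gamma> G" for t c
    unfolding Q_def
  proof (intro allI impI)
    fix c' assume c': "(e, t, c') \<in> darts \<Gamma> G"
    show "P (e, t, c')"
    proof (cases "c' = c")
      case False
      then have "0 < t" "t < 1" using c' that(2) by (auto simp: darts_def split: if_splits)
      then have "dart_node \<Gamma> (e, t, c) \<notin> vertex_points" using interior_not_vertex[OF e] by simp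
      from flip[OF that(2) this that(1)] False show ?thesis by simp
    qed (use that in simp)
  qed
  have up: "Q t" if t: "t \<in> stops \<Gamma> G e" "s < t" for t
    using t
  proof (induction "card {u \<in> stops \<Gamma> G e. u < t}" arbitrary: t rule: less_induct)
    case less
    let ?L = "{u \<in> stops \<Gamma> G e. u < t}"
    define m where "m = Max ?L"
    have L: "finite ?L" "s \<in> ?L" using fin s less.prems by auto
    then have m: "m \<in> ?L" "s \<le> m" unfolding m_def using Max_in[of ?L] Max_ge[of ?L s] by blast+
    have "Q m"
    proof (cases "s = m")
      case True
      then show ?thesis using Q start x by blast
    next
      case False
      have "card {u \<in> stops \<Gamma> G e. u < m} < card ?L"
        using m L by (intro psubset_card_mono) auto
      then show ?thesis using less.hyps m False by auto
    qed
    have t1: "t \<le> 1" using less.prems stops(3)[OF e] by auto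
    have "Min {u \<in> stops \<Gamma> G e. m < u} = t"
    proof (rule Min_eqI)
      fix u assume u: "u \<in> {u \<in> stops \<Gamma> G e. m < u}"
      show "t \<le> u"
      proof (rule ccontr)
        assume "\<not> t \<le> u"
        then have "u \<le> m" unfolding m_def using u L(1) by (intro Max_ge) auto
        then show False using u by simp
      qed
    qed (use fin less.prems m in auto)
    moreover have md: "(e, m, True) \<in> darts \<Gamma> G" using e m t1 by (auto simp: darts_def)
    ultimately have "P (e, t, False)" using rev[OF md] \<open>Q m\<close> unfolding Q_def by auto
    moreover have "(e, t, False) \<in> darts \<Gamma> G"
      using e less.prems s stops(3)[OF e] by (force simp: darts_def)
    ultimately show ?case by (rule Q)
  qed
  have down: "Q t" if t: "t \<in> stops \<Gamma> G e" "t < s" for t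
    using t
  proof (induction "card {u \<in> stops \<Gamma> G e. t < u}" arbitrary: t rule: less_induct)
    case less
    let ?L = "{u \<in> stops \<Gamma> G e. t < u}"
    define m where "m = Min ?L"
    have L: "finite ?L" "s \<in> ?L" using fin s less.prems by auto
    then have m: "m \<in> ?L" "m \<le> s" unfolding m_def using Min_in[of ?L] Min_le[of ?L s] by blast+
    have "Q m"
    proof (cases "s = m")
      case True
      then show ?thesis using Q start x by blast
    next
      case False
      have "card {u \<in> stops \<Gamma> G e. m < u} < card ?L"
        using m L by (intro psubset_card_mono) auto
      then show ?thesis using less.hyps m False by auto
    qed
    have t1: "0 \<le> t" using less.prems stops(3)[OF e] by auto
    have "Max {u \<in> stops \<Gamma> G e. u < m} = t"
    proof (rule Max_eqI)
      fix u assume u: "u \<in> {u \<in> stops \<Gamma> G e. u < m}"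
      show "u \<le> t"
      proof (rule ccontr)
        assume "\<not> u \<le> t"
        then have "m \<le> u" unfolding m_def using u L(1) by (intro Min_le) auto
        then show False using u by simp
      qed
    qed (use fin less.prems m in auto)
    moreover have md: "(e, m, False) \<in> darts \<Gamma> G" using e m t1 by (auto simp: darts_def)
    ultimately have "P (e, t, True)" using rev[OF md] \<open>Q m\<close> unfolding Q_def by auto
    moreover have "(e, t, True) \<in> darts \<Gamma> G"
      using e less.prems s stops(3)[OF e] by (force simp: darts_def)
    ultimately show ?case by (rule Q)
  qed
  obtain t c where yy: "y = (e, t, c)" using y(2) x by (cases y) (auto simp: dart_edge_def)
  have "t \<in> stops \<Gamma> G e" using y(1) yy by (auto simp: darts_def)
  then have "Q t" using up[of t] down[of t] Q start x by (cases t s rule: linorder_cases) auto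
  then show ?thesis using y(1) yy unfolding Q_def by blast
qed

section \<open>Colorings as solutions of inequalities\<close>

text \<open>
  No color has two edges crossing \<open>e\<close> iff any two edges that cross \<open>e\<close> have different colors.
\<close>

lemma coloring_iff_conflicts:
  "k_plane_edge_coloring 1 2 \<Gamma> G \<phi> \<longleftrightarrow>
     \<phi> ` edges G \<subseteq> {1, 2} \<and> (\<forall>f g. conflict f g \<longrightarrow> \<phi> f \<noteq> \<phi> g)"
proof -
  have 12: "{1..2} = {1, 2 :: nat}" "{Suc 0..2} = {1, 2}" by auto
  let ?S = "\<lambda>e c. {f \<in> edges G. f \<noteq> e \<and> \<phi> f = c \<and> (\<exists>p. crosses_at \<Gamma> e f p)}"
  have S: "card (?S e c) \<le> 1 \<longleftrightarrow> (\<forall>f\<in>?S e c. \<forall>g\<in>?S e c. f = g)" for e c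
  proof -
    have "finite (?S e c)" using finite_edges by simp
    then show ?thesis by (metis (no_types, lifting) One_nat_def card_le_Suc0_iff_eq)
  qed
  show ?thesis
  proof (intro iffI conjI)
    assume L: "k_plane_edge_coloring 1 2 \<Gamma> G \<phi>"
    then show sub: "\<phi> ` edges G \<subseteq> {1, 2}" by (simp add: k_plane_edge_coloring_def 12)
    show "\<forall>f g. conflict f g \<longrightarrow> \<phi> f \<noteq> \<phi> g"
    proof (intro allI impI notI)
      fix f g assume c: "conflict f g" and eq: "\<phi> f = \<phi> g"
      then obtain e where e: "e \<in> edges G" "f \<in> ?S e (\<phi> f)" "g \<in> ?S e (\<phi> f)" and "f \<noteq> g"
        unfolding conflict_def by force
      have "\<phi> f \<in> {1..2}" using c sub unfolding conflict_def 12 by blast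
      then have "card (?S e (\<phi> f)) \<le> 1" using L e(1) unfolding k_plane_edge_coloring_def by blast
      then show False using e(2,3) \<open>f \<noteq> g\<close> unfolding S by blast
    qed
  next
    assume R: "\<phi> ` edges G \<subseteq> {1, 2} \<and> (\<forall>f g. conflict f g \<longrightarrow> \<phi> f \<noteq> \<phi> g)"
    have "card (?S e c) \<le> 1" if e: "e \<in> edges G" for e c
      unfolding S
    proof (intro ballI, rule ccontr)
      fix f g assume fg: "f \<in> ?S e c" "g \<in> ?S e c" "f \<noteq> g"
      then have "conflict f g" unfolding conflict_def using e by blast
      then have "\<phi> f \<noteq> \<phi> g" using R by blast
      then show False using fg(1,2) by simp
    qed
    then show "k_plane_edge_coloring 1 2 \<Gamma> G \<phi>" using R by (simp add: k_plane_edge_coloring_def 12)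
  qed
qed

end

section \<open>The planarization determines the conflicts\<close>

locale planarized_drawing = two_plane_drawing +
  fixes D :: embedded_graph and \<beta> :: "nat \<Rightarrow> dart"
  assumes planarization: "planarization_of D \<beta> \<Gamma> G"
begin

lemma dart_numbering: "bij_betw \<beta> {..<num_darts D} (darts \<Gamma> G)"
  using planarization by (auto simp: planarization_of_def)

lemma dart_number: "x < num_darts D \<Longrightarrow> \<beta> x \<in> darts \<Gamma> G"
  using dart_numbering by (auto simp: bij_betw_def)

lemma number_of_dart: "d \<in> darts \<Gamma> G \<Longrightarrow> \<exists>x<num_darts D. \<beta> x = d"
  using bij_betw_imp_surj_on[OF dart_numbering] by (metis imageE lessThan_iff)

lemma rotation_data:
  assumes "x < num_darts D"
  shows "origin D x < num_nodes D" "twin D x < num_darts D" "rot D x < num_darts D"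
    and twin: "\<beta> (twin D x) = dart_rev \<Gamma> G (\<beta> x)"
    and rot: "ccw_next \<Gamma> G (\<beta> x) (\<beta> (rot D x))"
    and is_crossing_iff: "is_crossing D x \<longleftrightarrow> dart_node \<Gamma> (\<beta> x) \<notin> vertex_points"
    and origin_eq_iff: "y < num_darts D \<Longrightarrow>
      origin D x = origin D y \<longleftrightarrow> dart_node \<Gamma> (\<beta> x) = dart_node \<Gamma> (\<beta> y)"
proof -
  obtain \<alpha> where \<alpha>: "bij_betw \<alpha> {..<num_nodes D} (nodes \<Gamma> G)"
    "\<forall>v<num_nodes D. crossing_node D v \<longleftrightarrow> \<alpha> v \<notin> vertex_points"
    "\<forall>d<num_darts D.
             origin D d < num_nodes D \<and> \<alpha> (origin D d) = dart_node \<Gamma> (\<beta> d) \<and>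
             twin D d < num_darts D \<and> \<beta> (twin D d) = dart_rev \<Gamma> G (\<beta> d) \<and>
             rot D d < num_darts D \<and> ccw_next \<Gamma> G (\<beta> d) (\<beta> (rot D d))"
    using planarization unfolding planarization_of_def by blast
  show "origin D x < num_nodes D" "twin D x < num_darts D" "rot D x < num_darts D"
    "\<beta> (twin D x) = dart_rev \<Gamma> G (\<beta> x)" "ccw_next \<Gamma> G (\<beta> x) (\<beta> (rot D x))"
    using \<alpha>(3) assms by blast+
  have o: "origin D z \<in> {..<num_nodes D}" "\<alpha> (origin D z) = dart_node \<Gamma> (\<beta> z)"
    if "z < num_darts D" for z using \<alpha>(3) that by auto
  show "is_crossing D x \<longleftrightarrow> dart_node \<Gamma> (\<beta> x) \<notin> vertex_points"
    using \<alpha>(2) o[OF assms] by (simp add: is_crossing_def)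
  show "origin D x = origin D y \<longleftrightarrow> dart_node \<Gamma> (\<beta> x) = dart_node \<Gamma> (\<beta> y)" if "y < num_darts D"
  proof
    assume "dart_node \<Gamma> (\<beta> x) = dart_node \<Gamma> (\<beta> y)"
    then show "origin D x = origin D y"
      using o[OF assms] o[OF that] \<alpha>(1) unfolding bij_betw_def by (metis inj_onD)
  next
    assume "origin D x = origin D y"
    then show "dart_node \<Gamma> (\<beta> x) = dart_node \<Gamma> (\<beta> y)" using o(2)[OF assms] o(2)[OF that] by simp
  qed
qed

abbreviation edge :: "nat \<Rightarrow> nat set" where
  "edge x \<equiv> dart_edge (\<beta> x)"

abbreviation node :: "nat \<Rightarrow> complex" where
  "node x \<equiv> dart_node \<Gamma> (\<beta> x)"

lemma edge_node:
  assumes "x < num_darts D"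
  shows "edge x \<in> edges G" "node x \<in> edge_image (edge x)"
  using dart_cases dart_number assms by blast+

lemma edge_twin: "x < num_darts D \<Longrightarrow> edge (twin D x) = edge x"
  by (simp add: twin)

lemma node_rot: "x < num_darts D \<Longrightarrow> node (rot D x) = node x"
  using ccw_next_dart[OF rot] by simp

lemma is_crossing_rot:
  assumes "x < num_darts D"
  shows "is_crossing D (rot D x) = is_crossing D x"
  unfolding is_crossing_iff[OF assms] is_crossing_iff[OF rotation_data(3)[OF assms]] node_rot[OF assms] ..

lemma edge_rot:
  assumes "x < num_darts D" "is_crossing D x"
  shows "edge (rot D x) \<noteq> edge x"
  using ccw_next_other_edge[OF dart_number[OF assms(1)] _ rot[OF assms(1)]] assms(2)
  unfolding is_crossing_iff[OF assms(1)] by blast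

lemma rot_rot:
  assumes "x < num_darts D" "is_crossing D x"
  shows "\<beta> (rot D (rot D x)) = flip (\<beta> x)"
  using ccw_next_twice[OF dart_number[OF assms(1)] _ rot[OF assms(1)] rot[OF rotation_data(3)[OF assms(1)]]]
    assms(2)
  unfolding is_crossing_iff[OF assms(1)] by blast

lemma crosses_at_node:
  assumes "x < num_darts D" "y < num_darts D" "node x = node y" "is_crossing D x" "edge x \<noteq> edge y"
  shows "crosses_at \<Gamma> (edge x) (edge y) (node x)"
proof (rule common_point_crossing)
  show "node x \<in> edge_image (edge y)" using edge_node(2)[OF assms(2)] assms(3) by metis
  show "node x \<notin> vertex_points" using is_crossing_iff[OF assms(1)] assms(4) by blast
qed (use edge_node assms in blast)+

lemma reaches_other_crossing_iff:
  assumes x: "x < num_darts D" "is_crossing D x"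
  shows "reaches_other_crossing D x \<longleftrightarrow>
    dart_node \<Gamma> (dart_rev \<Gamma> G (\<beta> x)) = node (twin D (rot D x)) \<or>
    dart_node \<Gamma> (dart_rev \<Gamma> G (flip (\<beta> x))) = node (twin D (rot D x))"
proof -
  have less: "twin D x < num_darts D" "rot D x < num_darts D" "twin D (rot D x) < num_darts D"
    "rot D (rot D x) < num_darts D" "twin D (rot D (rot D x)) < num_darts D"
    using x rotation_data(2,3) by auto
  show ?thesis
    unfolding reaches_other_crossing_def origin_eq_iff[OF less(1,3)] origin_eq_iff[OF less(5,3)]
      twin[OF x(1)] twin[OF less(4)] rot_rot[OF x] ..
qed

lemma constraint_same_edge:
  assumes "x < num_darts D" "(y, False) \<in> constraints D x"
  shows "edge y = edge x"
proof -
  have "y = twin D x \<or> is_crossing D x \<and> y = rot D (rot D x)"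
    using assms(2) by (auto simp: constraints_def split: if_splits)
  then show ?thesis
  proof
    assume "is_crossing D x \<and> y = rot D (rot D x)"
    then show ?thesis using rot_rot[OF assms(1)] dart_edge_flip by metis
  qed (use edge_twin[OF assms(1)] in blast)
qed

text \<open>
  The piece of the crossing edge that leaves along \<open>rot D x\<close> connects a crossing with the edge of \<open>x\<close> to a
  crossing with the edge of \<open>y\<close>. If these two edges were the same, this edge would have its two crossings
  at the ends of the piece, and following it from \<open>x\<close> or from the opposite dart would lead to
  the far end.
\<close>

lemma constraint_conflict:
  assumes x: "x < num_darts D" and "(y, True) \<in> constraints D x"
  shows "conflict (edge x) (edge y)"
proof -
  define u where "u = rot D x"
  define w where "w = twin D u"
  have c: "is_crossing D x" "is_crossing D w" "\<not> reaches_other_crossing D x" "y = rot D w"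
    using assms(2) by (auto simp: constraints_def u_def w_def split: if_splits)
  have less: "u < num_darts D" "w < num_darts D" "y < num_darts D"
    using x rotation_data(2,3) by (auto simp: u_def w_def c(4))
  have nu: "node u = node x" "edge u \<noteq> edge x" "is_crossing D u"
    using node_rot edge_rot is_crossing_rot x c(1) by (auto simp: u_def)
  have ny: "node y = node w" "edge y \<noteq> edge w" "edge w = edge u"
    using node_rot[OF less(2)] edge_rot[OF less(2) c(2)] edge_twin[OF less(1)] by (simp_all add: c(4) w_def)
  have "is_crossing D y" using is_crossing_rot less c by simp
  have cr: "crosses_at \<Gamma> (edge u) (edge x) (node x)" "crosses_at \<Gamma> (edge u) (edge y) (node w)"
    using crosses_at_node[OF less(1) x] crosses_at_node[OF less(2,3)] nu ny c(2) by auto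
  have "edge x \<noteq> edge y"
  proof
    assume eq: "edge x = edge y"
    have "crosses_at \<Gamma> (edge x) (edge u) (node x)" "crosses_at \<Gamma> (edge x) (edge w) (node w)"
      using crosses_at_node[OF x less(1)] crosses_at_node[OF less(3,2)] nu ny c(1) eq \<open>is_crossing D y\<close> by auto
    then have "node x \<in> crossings (edge x)" "node w \<in> crossings (edge x)"
      using edge_node(1) less nu(2) ny(3) unfolding crossings_def by auto
    moreover have "node w \<noteq> node x"
      using dart_rev_node_neq[OF dart_number[OF less(1)]] nu(1) twin[OF less(1)] by (simp add: w_def)
    ultimately have "reaches_other_crossing D x"
      using dart_rev_to_other_crossing[OF dart_number[OF x]]
      unfolding reaches_other_crossing_iff[OF x c(1)] u_def[symmetric] w_def[symmetric] by blast
    then show False using c(3) by blast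
  qed
  then show ?thesis
    unfolding conflict_def using edge_node(1) x less cr nu(2) ny by metis
qed

text \<open>
  Rotating twice at a crossing gives the opposite dart, so the equality constraints realize the moves
  of \<open>dart_edge_induct\<close>.
\<close>

lemma same_edge_closed:
  assumes S: "S \<subseteq> {..<num_darts D}" "\<And>z y. z \<in> S \<Longrightarrow> (y, False) \<in> constraints D z \<Longrightarrow> y \<in> S"
    and x: "x \<in> S" and y: "y < num_darts D" "edge y = edge x"
  shows "y \<in> S"
proof -
  have "\<beta> y \<in> \<beta> ` S"
  proof (rule dart_edge_induct[of "\<beta> x" "\<lambda>d. d \<in> \<beta> ` S"])
    fix d assume "d \<in> \<beta> ` S"
    then obtain z where z: "z \<in> S" "d = \<beta> z" by blast
    then have zM: "z < num_darts D" using S(1) by auto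
    have "twin D z \<in> S" using S(2)[OF z(1)] by (simp add: constraints_def)
    then show "dart_rev \<Gamma> G d \<in> \<beta> ` S" using twin[OF zM] z(2) by (metis imageI)
    assume "dart_node \<Gamma> d \<notin> vertex_points"
    then have c: "is_crossing D z" using is_crossing_iff zM z(2) by simp
    then have "rot D (rot D z) \<in> S" using S(2)[OF z(1)] by (simp add: constraints_def)
    then show "flip d \<in> \<beta> ` S" using rot_rot[OF zM c] z(2) by (metis imageI)
  qed (use x y S dart_number in auto)
  then obtain z where "z \<in> S" "\<beta> z = \<beta> y" by auto
  moreover have "inj_on \<beta> {..<num_darts D}" using dart_numbering by (simp add: bij_betw_def)
  ultimately show ?thesis using y S(1) by (metis inj_onD lessThan_iff subsetD)
qed

text \<open>
  A conflict comes from a piece of an edge \<open>e\<close> with \<open>f\<close> crossing at one end and \<open>g\<close> at the other.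
  Of the two darts of \<open>f\<close> at its end, one has the dart \<open>u\<close> of this piece as rotation successor.
\<close>

lemma conflict_constraint:
  assumes "conflict f g"
  shows "\<exists>x<num_darts D. \<exists>y. (y, True) \<in> constraints D x \<and> edge x = f \<and> edge y = g"
proof -
  obtain e p q where e: "e \<in> edges G" "e \<noteq> f" "e \<noteq> g" "crosses_at \<Gamma> e f p" "crosses_at \<Gamma> e g q"
    and fg: "f \<in> edges G" "g \<in> edges G" "f \<noteq> g"
    using assms unfolding conflict_def by blast
  have np: "p \<notin> vertex_points" "q \<notin> vertex_points" using crossing_not_vertex e by blast+
  have on: "p \<in> edge_image e" "p \<in> edge_image f" "q \<in> edge_image e" "q \<in> edge_image g" using crossing_on_edges e by blast+
  have nqf: "q \<notin> edge_image f" using at_most_two_edges[of e g f q] e fg on np by blast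
  then have "p \<noteq> q" using on by blast
  have pc: "p \<in> crossings e" "q \<in> crossings e" "p \<in> crossings f" "q \<in> crossings g"
    using e fg crosses_at_sym[of e f p] crosses_at_sym[of e g q] unfolding crossings_def by blast+
  obtain u where u: "u \<in> darts \<Gamma> G" "dart_edge u = e" "dart_node \<Gamma> u = p" "dart_node \<Gamma> (dart_rev \<Gamma> G u) = q"
  proof -
    obtain u where u: "u \<in> darts \<Gamma> G" "dart_edge u = e" "dart_node \<Gamma> u = p"
      using dart_at_crossing[OF e(1) pc(1)] by blast
    then have "dart_node \<Gamma> (dart_rev \<Gamma> G u) = q \<or> dart_node \<Gamma> (dart_rev \<Gamma> G (flip u)) = q"
      using dart_rev_to_other_crossing[OF u(1)] pc \<open>p \<noteq> q\<close> by auto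
    moreover have "flip u \<in> darts \<Gamma> G" using flip_dart u np by simp
    ultimately show ?thesis using that[of u] that[of "flip u"] u by auto
  qed
  obtain x where x: "x < num_darts D" "edge x = f" "node x = p" "\<beta> (rot D x) = u"
  proof -
    obtain j where j: "j < num_darts D" "edge j = f" "node j = p"
      using dart_at_crossing[OF fg(1) pc(3)] number_of_dart by metis
    have cj: "is_crossing D j" using is_crossing_iff j np by simp
    have jM: "rot D j < num_darts D" "rot D (rot D j) < num_darts D" using rotation_data(3) j by auto
    have "edge (rot D j) = e"
      using dart_edges_at_crossing[OF u(1) dart_number[OF j(1)] dart_number[OF jM(1)]]
        u j np node_rot[OF j(1)] edge_rot[OF j(1) cj] e by simp
    then have "\<beta> (rot D j) = u \<or> \<beta> (rot D j) = flip u"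
      using same_edge_same_node[OF u(1) dart_number[OF jM(1)]] u j node_rot[OF j(1)] by simp
    then show ?thesis
    proof
      \<comment> \<open>then the dart of \<open>f\<close> opposite to \<open>j\<close> is the right one\<close>
      assume "\<beta> (rot D j) = flip u"
      then have "\<beta> (rot D (rot D (rot D j))) = u"
        using rot_rot[OF jM(1)] is_crossing_rot[OF j(1)] cj by simp
      then show ?thesis using that[OF jM(2)] rot_rot[OF j(1) cj] j by simp
    qed (use that j in blast)
  qed
  define w where "w = twin D (rot D x)"
  define y where "y = rot D w"
  have less: "rot D x < num_darts D" "w < num_darts D" "y < num_darts D"
    using rotation_data(2,3) x(1) by (auto simp: w_def y_def)
  have \<beta>w: "\<beta> w = dart_rev \<Gamma> G u" using twin[OF less(1)] x by (simp add: w_def)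
  have w: "edge w = e" "node w = q" using u \<beta>w by auto
  have c: "is_crossing D x" "is_crossing D w" using is_crossing_iff x less w np by auto
  have "node y = q" "edge y \<noteq> e" using node_rot[OF less(2)] edge_rot[OF less(2) c(2)] w by (auto simp: y_def)
  moreover obtain z where "z \<in> darts \<Gamma> G" "dart_edge z = g" "dart_node \<Gamma> z = q"
    using dart_at_crossing[OF fg(2) pc(4)] by blast
  ultimately have "edge y = g"
    using dart_edges_at_crossing[of z "\<beta> w" "\<beta> y"] dart_number less w np e by simp
  have "\<not> reaches_other_crossing D x"
  proof -
    let ?x' = "rot D (rot D x)"
    have x'M: "?x' < num_darts D" using rotation_data(3) less by blast
    have "edge (twin D x) = f" "edge (twin D ?x') = f"
      using edge_twin[OF x(1)] edge_twin[OF x'M] rot_rot[OF x(1) c(1)] x by auto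
    then have "node (twin D x) \<in> edge_image f" "node (twin D ?x') \<in> edge_image f"
      using edge_node(2) rotation_data(2) x(1) x'M by metis+
    then show ?thesis
      using nqf w(2) twin[OF x(1)] twin[OF x'M] rot_rot[OF x(1) c(1)]
      unfolding reaches_other_crossing_iff[OF x(1) c(1)] w_def by auto
  qed
  then have "(y, True) \<in> constraints D x" using c by (simp add: constraints_def w_def y_def)
  then show ?thesis using x \<open>edge y = g\<close> by blast
qed

text \<open>
  A closed set of darts consists of all darts of a set of edges, and this set of edges is closed under
  conflicts. As conflicts are symmetric, the other edges are closed under conflicts too.
\<close>

sublocale rotation_system D
proof
  fix S assume S: "S \<subseteq> {..<num_darts D}" "closed_under D S"
  have cl: "y \<in> S" if "x \<in> S" "(y, b) \<in> constraints D x" for x y b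
    using S(2) that unfolding closed_under_def by blast
  have same: "y \<in> S" if "x \<in> S" "y < num_darts D" "edge y = edge x" for x y
    by (rule same_edge_closed[OF S(1) _ that]) (rule cl)
  show "closed_under D ({..<num_darts D} - S)"
    unfolding closed_under_def
  proof (intro ballI, clarify)
    fix x y b assume x: "x < num_darts D" "x \<notin> S" and xy: "(y, b) \<in> constraints D x"
    have y: "y < num_darts D" using xy rotation_data(2,3) x(1) by (auto simp: constraints_def split: if_splits)
    moreover have "y \<notin> S"
    proof
      assume yS: "y \<in> S"
      show False
      proof (cases b)
        case True
        have "conflict (edge y) (edge x)" using conflict_sym constraint_conflict x(1) xy True by simp
        then obtain y' x' where *: "y' < num_darts D" "(x', True) \<in> constraints D y'" "edge y' = edge y" "edge x' = edge x"
          using conflict_constraint by blast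
        then have "y' \<in> S" using same yS by blast
        then show False using cl * same x by metis
      next
        case False
        then show False using constraint_same_edge[OF x(1)] xy same[OF yS x(1)] x(2) by simp
      qed
    qed
    ultimately show "y \<in> {..<num_darts D} - S" by simp
  qed
qed (use rotation_data(1-3) in simp_all)

lemma solution_coloring:
  assumes "solution D \<psi>"
  shows "\<exists>\<phi>. k_plane_edge_coloring 1 2 \<Gamma> G \<phi> \<and> (\<forall>x<num_darts D. \<psi> x = \<phi> (edge x))"
proof -
  define \<phi> where "\<phi> e = \<psi> (SOME x. x < num_darts D \<and> edge x = e)" for e
  have same: "\<psi> y = \<psi> x" if "x < num_darts D" "y < num_darts D" "edge y = edge x" for x y
  proof -
    let ?S = "{z. z < num_darts D \<and> \<psi> z = \<psi> x}"
    have "y \<in> ?S"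
    proof (rule same_edge_closed[OF _ _ _ that(2,3)])
      fix z y assume z: "z \<in> ?S" and zy: "(y, False) \<in> constraints D z"
      then have "z < num_darts D" "\<psi> z = \<psi> x" by auto
      then show "y \<in> ?S" using constraints_less[OF _ zy] solutionD(2)[OF assms _ zy] by simp
    qed (use that in auto)
    then show ?thesis by simp
  qed
  have \<phi>: "\<psi> x = \<phi> (edge x)" if "x < num_darts D" for x
    unfolding \<phi>_def
  proof (rule someI2[of _ x])
    fix y assume "y < num_darts D \<and> edge y = edge x"
    then show "\<psi> x = \<psi> y" using same[OF that, of y] by simp
  qed (use that in simp)
  have "\<phi> ` edges G \<subseteq> {1, 2}"
  proof
    fix c assume "c \<in> \<phi> ` edges G"
    then obtain e where e: "e \<in> edges G" "c = \<phi> e" by blast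
    then have "(e, 0, True) \<in> darts \<Gamma> G" using end_stops by (auto simp: darts_def)
    then obtain x where "x < num_darts D" "edge x = e" using number_of_dart by (metis dart_edge_def fst_conv)
    then show "c \<in> {1, 2}" using \<phi>[of x] solutionD(1)[OF assms, of x] e(2) by simp
  qed
  moreover have "\<phi> f \<noteq> \<phi> g" if fg: "conflict f g" for f g
  proof -
    obtain x y where xy: "x < num_darts D" "(y, True) \<in> constraints D x" "edge x = f" "edge y = g"
      using conflict_constraint[OF fg] by blast
    have "\<psi> y \<noteq> \<psi> x" using solutionD(2)[OF assms xy(1,2)] by simp
    then show ?thesis using \<phi>[OF xy(1)] \<phi>[OF constraints_less[OF xy(1,2)]] xy(3,4) by metis
  qed
  ultimately show ?thesis using \<phi> coloring_iff_conflicts by blast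
qed

lemma coloring_solution:
  assumes "k_plane_edge_coloring 1 2 \<Gamma> G \<phi>"
  shows "solution D (\<lambda>x. \<phi> (edge x))"
proof -
  have \<phi>: "\<phi> ` edges G \<subseteq> {1, 2}" "\<And>f g. conflict f g \<Longrightarrow> \<phi> f \<noteq> \<phi> g"
    using assms unfolding coloring_iff_conflicts by blast+
  have "\<phi> (edge x) \<in> {1, 2}" if "x < num_darts D" for x using \<phi>(1) edge_node(1)[OF that] by blast
  moreover have "\<phi> (edge y) \<noteq> \<phi> (edge x) \<longleftrightarrow> b" if "x < num_darts D" "(y, b) \<in> constraints D x" for x y b
  proof (cases b)
    case True
    then have "conflict (edge x) (edge y)" using constraint_conflict that by simp
    then show ?thesis using \<phi>(2) True by metis
  next
    case False
    then show ?thesis using constraint_same_edge[OF that(1)] that(2) by simp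
  qed
  ultimately show ?thesis unfolding solution_def by blast
qed

lemma num_darts_le: "num_darts D \<le> 8 * card (edges G)"
  using bij_betw_same_card[OF dart_numbering] card_darts_le by simp

end

section \<open>The linear-time algorithm\<close>

theorem theorem6p1:
  "\<exists>(P :: program) (T :: nat \<Rightarrow> nat).
     (\<lambda>k. real (T k)) \<in> O(\<lambda>k. real k) \<and>
     (\<forall>G \<Gamma> D \<beta>.
        simple_graph G \<and> drawing_of \<Gamma> G \<and> k_plane 2 \<Gamma> G \<and> planarization_of D \<beta> \<Gamma> G \<longrightarrow>
        (\<exists>t s. exec P (input_state D) t s \<and>
               t \<le> T (card (verts G) + card (edges G)) \<and>
               (output_answer s = 1 \<and>
                  (\<exists>\<phi>. k_plane_edge_coloring 1 2 \<Gamma> G \<phi> \<and>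
                       (\<forall>d<num_darts D. output_color s d = \<phi> (dart_edge (\<beta> d))))
                \<or> output_answer s = 0 \<and> \<not> (\<exists>\<phi>. k_plane_edge_coloring 1 2 \<Gamma> G \<phi>))))"
proof -
  \<comment> \<open>three iterations per dart and at most eight darts per edge give the factor 24\<close>
  define T where "T k = 3 + (1 + cost step) * (24 * k)" for k
  have "(\<lambda>k. real (T k)) \<in> O(\<lambda>k. real k)"
  proof (rule bigoI[of _ "3 + (1 + real (cost step)) * 24"])
    show "\<forall>\<^sub>F k in sequentially. norm (real (T k)) \<le> (3 + (1 + real (cost step)) * 24) * norm (real k)"
      using eventually_ge_at_top[of 1] by eventually_elim (auto simp: T_def algebra_simps)
  qed
  moreover have "\<exists>t s. exec color_darts (input_state D) t s \<and>
      t \<le> T (card (verts G) + card (edges G)) \<and>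
      (output_answer s = 1 \<and>
         (\<exists>\<phi>. k_plane_edge_coloring 1 2 \<Gamma> G \<phi> \<and>
              (\<forall>d<num_darts D. output_color s d = \<phi> (dart_edge (\<beta> d))))
       \<or> output_answer s = 0 \<and> \<not> (\<exists>\<phi>. k_plane_edge_coloring 1 2 \<Gamma> G \<phi>))"
    if "simple_graph G \<and> drawing_of \<Gamma> G \<and> k_plane 2 \<Gamma> G \<and> planarization_of D \<beta> \<Gamma> G" for G \<Gamma> D \<beta>
  proof -
    interpret planarized_drawing G \<Gamma> D \<beta> using that by unfold_locales auto
    obtain t s where ts: "exec color_darts (input_state D) t s" "t \<le> 3 + (1 + cost step) * (3 * num_darts D)"
      "reg s 0 = 1 \<and> solution D (arr s 4) \<or> reg s 0 = 0 \<and> (\<nexists>\<psi>. solution D \<psi>)"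
      using color_darts_correct by blast
    have "(1 + cost step) * (3 * num_darts D) \<le> (1 + cost step) * (24 * (card (verts G) + card (edges G)))"
      using num_darts_le by (intro mult_le_mono2) simp
    then have "t \<le> T (card (verts G) + card (edges G))" using ts(2) unfolding T_def by linarith
    then show ?thesis using ts(1,3) solution_coloring[of "arr s 4"] coloring_solution
      unfolding output_answer_def output_color_def by blast
  qed
  ultimately show ?thesis by blast
qed

end
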